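(* The algebra $X(\mathfrak g,\mathcal G)^{tw}$ is a left coideal subalgebra of $X(\mathfrak g)$: $$\Delta\big(X(\mathfrak g,\mathcal G)^{tw}\big)\subset X(\mathfrak g)\otimes X(\mathfrak g,\mathcal G)^{tw}.$$
   Context: Notation. Tensor products are over $\mathbb C$. $\mathfrak g$ is $\mathfrak{so}_N$ ($N=2n$ or $N=2n+1$) or $\mathfrak{sp}_N$ ($N=2n$), $n\ge1$. Rows and columns of $N\times N$ matrices are indexed by $-n,\dots,-1,1,\dots,n$ if $N=2n$ and by $-n,\dots,n$ (including $0$) if $N=2n+1$. $\theta_{ij}=1$ in the orthogonal case and $\theta_{ij}=\mathrm{sign}(i)\,\mathrm{sign}(j)$ in the symplectic case. The transposition $t$ is $(E_{ij})^t=\theta_{ij}E_{-j,-i}$. In $\mp$ the upper sign is for the orthogonal case, the lower for the symplectic case. $\kappa=N/2\mp1$. $P=\sum_{i,j}E_{ij}\otimes E_{ji}$, $Q=\sum_{i,j}\theta_{ij}E_{ij}\otimes E_{-i,-j}$, $R(u)=I-\frac{P}{u}+\frac{Q}{u-\kappa}$. Extended Yangian. $X(\mathfrak g)$ is the associative unital $\mathbb C$-algebra with generators $t_{ij}^{(r)}$, $r\ge 0$, $t_{ij}^{(0)}=\delta_{ij}$, and relations $R(u-v)T_1(u)T_2(v)=T_2(v)T_1(u)R(u-v)$, where $T(u)=\sum_{i,j}E_{ij}\otimes t_{ij}(u)$, $t_{ij}(u)=\sum_{r\ge0}t_{ij}^{(r)}u^{-r}$. It is a Hopf algebra with coproduct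 $\Delta(t_{ij}(u))=\sum_kt_{ik}(u)\otimes t_{kj}(u)$. The matrix $\mathcal G$ is one of the following. BCD0: $\mathcal G=I$. CI ($\mathfrak g=\mathfrak{sp}_N$) and DIII ($\mathfrak g=\mathfrak{so}_N$, $N$ even): $\mathcal G=\sum_{i=1}^{N/2}(E_{ii}-E_{-i,-i})$. CII ($\mathfrak g=\mathfrak{sp}_N$, $N=p+q$, $p,q$ even, $p\ge q>0$): $\mathcal G=-\sum_{i=1}^{q/2}(E_{ii}+E_{-i,-i})+\sum_{i=q/2+1}^{N/2}(E_{ii}+E_{-i,-i})$. BDI ($\mathfrak g=\mathfrak{so}_N$, $N=p+q$, with $p>q>0$ if $N$ is odd, $p\ge q>0$ if $N$ is even): $\mathcal G=\sum_{i=1}^{(p-q)/2}(E_{ii}+E_{-i,-i})+\sum_{i=(p-q)/2+1}^{N/2}(E_{-i,i}+E_{i,-i})$ for $N$ even, and $\mathcal G=\sum_{i=-(p-q-1)/2}^{(p-q-1)/2}E_{ii}+\sum_{i=(p-q+1)/2}^{(N-1)/2}(E_{-i,i}+E_{i,-i})$ for $N$ odd. Set $\mathcal G(u)=\mathcal G$ in types BCD0, CI, DIII and in types BDI, CII with $p=q$; set $\mathcal G(u)=(I-cu\,\mathcal G)(1-cu)^{-1}$, $c=\frac{4}{p-q}$, in types BDI, CII with $p>q$ (expanded in $u^{-1}$). $X(\mathfrak g,\mathcal G)^{tw}$ is the subalgebra of $X(\mathfrak g)$ generated by the coefficients of the entries of $S(u)=T(u-\kappa/2)\,\mathcal G(u)\,T^t(-u+\kappa/2)$.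 *)

theory Defs
  imports
    "HOL-Library.Poly_Mapping"
    "HOL-Computational_Algebra.Formal_Laurent_Series"
    "HOL-Algebra.Module"
    "HOL-Algebra.QuotRing"
    "HOL-Algebra.Subrings"
begin

section \<open>Associative unital algebras over the complex numbers\<close>

text \<open>Algebras are records of type \<open>(complex, 'a) module\<close>.  The library locale \<open>algebra\<close>
  is not used because it is restricted to commutative algebras.\<close>

definition complex_ring :: "complex ring" where
  "complex_ring = \<lparr>carrier = UNIV, mult = (*), one = 1, zero = 0, add = (+)\<rparr>"

definition linear_span :: "(complex, 'a) module \<Rightarrow> 'a set \<Rightarrow> 'a set" where
  "linear_span A S = \<Inter>{H. submodule H complex_ring A \<and> S \<subseteq> H}"

definition subalg :: "'a set \<Rightarrow> (complex, 'a) module \<Rightarrow> bool" where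
  "subalg H A \<longleftrightarrow> subring H A \<and> submodule H complex_ring A"

definition generated_subalg :: "(complex, 'a) module \<Rightarrow> 'a set \<Rightarrow> 'a set" where
  "generated_subalg A S = \<Inter>{H. subalg H A \<and> S \<subseteq> H}"

definition quotient_alg :: "(complex, 'a) module \<Rightarrow> 'a set \<Rightarrow> (complex, 'a set) module" where
  "quotient_alg A J =
    \<lparr>carrier = carrier (A Quot J), mult = mult (A Quot J), one = one (A Quot J),
     zero = zero (A Quot J), add = add (A Quot J),
     smult = (\<lambda>c x. \<Union>a\<in>x. J +>\<^bsub>A\<^esub> (c \<odot>\<^bsub>A\<^esub> a))\<rparr>"


subsection \<open>Tensor products\<close>

text \<open>The free vector space on \<open>carrier A \<times> carrier B\<close>, with the bilinear extension of
  \<open>(a, b) (a', b') = (a a', b b')\<close> as product.\<close>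

definition pair_alg ::
    "(complex, 'a) module \<Rightarrow> (complex, 'b) module \<Rightarrow> (complex, ('a \<times> 'b) \<Rightarrow>\<^sub>0 complex) module" where
  "pair_alg A B =
    \<lparr>carrier = {p. Poly_Mapping.keys p \<subseteq> carrier A \<times> carrier B},
     mult = (\<lambda>p q. \<Sum>x\<in>Poly_Mapping.keys p. \<Sum>y\<in>Poly_Mapping.keys q.
        Poly_Mapping.single (fst x \<otimes>\<^bsub>A\<^esub> fst y, snd x \<otimes>\<^bsub>B\<^esub> snd y)
          (Poly_Mapping.lookup p x * Poly_Mapping.lookup q y)),
     one = Poly_Mapping.single (\<one>\<^bsub>A\<^esub>, \<one>\<^bsub>B\<^esub>) 1,
     zero = 0,
     add = (+),
     smult = (\<lambda>c. Poly_Mapping.map ((*) c))\<rparr>"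

definition bilinear_relations ::
    "(complex, 'a) module \<Rightarrow> (complex, 'b) module \<Rightarrow> (('a \<times> 'b) \<Rightarrow>\<^sub>0 complex) set" where
  "bilinear_relations A B =
     {Poly_Mapping.single (a \<oplus>\<^bsub>A\<^esub> a', b) 1 - Poly_Mapping.single (a, b) 1
        - Poly_Mapping.single (a', b) 1 |a a' b.
        a \<in> carrier A \<and> a' \<in> carrier A \<and> b \<in> carrier B} \<union>
     {Poly_Mapping.single (a, b \<oplus>\<^bsub>B\<^esub> b') 1 - Poly_Mapping.single (a, b) 1
        - Poly_Mapping.single (a, b') 1 |a b b'.
        a \<in> carrier A \<and> b \<in> carrier B \<and> b' \<in> carrier B} \<union>
     {Poly_Mapping.single (c \<odot>\<^bsub>A\<^esub> a, b) 1 - Poly_Mapping.single (a, b) c |a b c.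
        a \<in> carrier A \<and> b \<in> carrier B} \<union>
     {Poly_Mapping.single (a, c \<odot>\<^bsub>B\<^esub> b) 1 - Poly_Mapping.single (a, b) c |a b c.
        a \<in> carrier A \<and> b \<in> carrier B}"

definition tensor_null ::
    "(complex, 'a) module \<Rightarrow> (complex, 'b) module \<Rightarrow> (('a \<times> 'b) \<Rightarrow>\<^sub>0 complex) set" where
  "tensor_null A B = linear_span (pair_alg A B) (bilinear_relations A B)"

text \<open>The span of the bilinear relations is a two-sided ideal of \<open>pair_alg A B\<close>, hence the
  quotient below is the usual tensor product of vector spaces with its usual product.\<close>

definition tensor_alg ::
    "(complex, 'a) module \<Rightarrow> (complex, 'b) module \<Rightarrow> (complex, (('a \<times> 'b) \<Rightarrow>\<^sub>0 complex) set) module"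
  where "tensor_alg A B = quotient_alg (pair_alg A B) (tensor_null A B)"

definition pure_tensor ::
    "(complex, 'a) module \<Rightarrow> (complex, 'b) module \<Rightarrow> 'a \<Rightarrow> 'b \<Rightarrow> (('a \<times> 'b) \<Rightarrow>\<^sub>0 complex) set" where
  "pure_tensor A B a b = tensor_null A B +>\<^bsub>pair_alg A B\<^esub> Poly_Mapping.single (a, b) 1"

text \<open>For subspaces \<open>U\<close> of \<open>A\<close> and \<open>V\<close> of \<open>B\<close>, the tensor product of \<open>U\<close> and \<open>V\<close> regarded as
  a subspace of that of \<open>A\<close> and \<open>B\<close> (the canonical map is injective over a field).\<close>

definition tensor_subspace ::
    "(complex, 'a) module \<Rightarrow> (complex, 'b) module \<Rightarrow> 'a set \<Rightarrow> 'b set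
      \<Rightarrow> (('a \<times> 'b) \<Rightarrow>\<^sub>0 complex) set set" where
  "tensor_subspace A B U V =
     linear_span (tensor_alg A B) {pure_tensor A B a b |a b. a \<in> U \<and> b \<in> V}"


subsection \<open>Free algebras\<close>

text \<open>Polynomial mappings multiply by convolution over an additive monoid of exponents; words are
  made such a (noncommutative) monoid, with concatenation as addition.\<close>

datatype 'g word = Word (letters: "'g list")

instantiation word :: (type) monoid_add
begin

definition "0 = Word []"
definition "v + w = Word (letters v @ letters w)"

instance
  by standard (simp_all add: zero_word_def plus_word_def)

end

type_synonym 'g free = "'g word \<Rightarrow>\<^sub>0 complex"

definition scalar :: "complex \<Rightarrow> 'g free" where
  "scalar c = Poly_Mapping.single 0 c"

definition letter :: "'g \<Rightarrow> 'g free" where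
  "letter g = Poly_Mapping.single (Word [g]) 1"

definition free_alg :: "'g set \<Rightarrow> (complex, 'g free) module" where
  "free_alg G =
    \<lparr>carrier = {p. \<forall>w\<in>Poly_Mapping.keys p. set (letters w) \<subseteq> G},
     mult = (*), one = 1, zero = 0, add = (+), smult = (\<lambda>c p. scalar c * p)\<rparr>"

text \<open>The homomorphism from the free algebra to \<open>B\<close> sending each generator \<open>g\<close> to \<open>f g\<close>.\<close>

definition free_lift :: "(complex, 'b) module \<Rightarrow> ('g \<Rightarrow> 'b) \<Rightarrow> 'g free \<Rightarrow> 'b" where
  "free_lift B f p =
     (\<Oplus>\<^bsub>B\<^esub>w\<in>Poly_Mapping.keys p.
        Poly_Mapping.lookup p w \<odot>\<^bsub>B\<^esub> foldr (\<lambda>g z. f g \<otimes>\<^bsub>B\<^esub> z) (letters w) \<one>\<^bsub>B\<^esub>)"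


section \<open>The extended Yangian\<close>

datatype family = Orthogonal | Symplectic

definition index_set :: "nat \<Rightarrow> int set" where
  "index_set N =
     (if even N then {- int (N div 2)..int (N div 2)} - {0} else {- int (N div 2)..int (N div 2)})"

definition theta :: "family \<Rightarrow> int \<Rightarrow> int \<Rightarrow> complex" where
  "theta F i j = (case F of Orthogonal \<Rightarrow> 1 | Symplectic \<Rightarrow> of_int (sgn i * sgn j))"

definition kappa :: "family \<Rightarrow> nat \<Rightarrow> complex" where
  "kappa F N = (case F of Orthogonal \<Rightarrow> of_nat N / 2 - 1 | Symplectic \<Rightarrow> of_nat N / 2 + 1)"

definition unit_matrix :: "int \<Rightarrow> int \<Rightarrow> int \<Rightarrow> int \<Rightarrow> 'a::zero_neq_one" where
  "unit_matrix i j k l = (if k = i \<and> l = j then 1 else 0)"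

text \<open>For a tensor \<open>M\<close> in the square of the matrix algebra, \<open>M i j k l\<close> is the coefficient of
  the tensor product of the matrix units \<open>E\<^bsub>ij\<^esub>\<close> and \<open>E\<^bsub>kl\<^esub>\<close>.\<close>

type_synonym 'a tensor_matrix = "int \<Rightarrow> int \<Rightarrow> int \<Rightarrow> int \<Rightarrow> 'a"

definition tensor_matrix_mult ::
    "nat \<Rightarrow> 'a::semiring_0 tensor_matrix \<Rightarrow> 'a tensor_matrix \<Rightarrow> 'a tensor_matrix" where
  "tensor_matrix_mult N A B i j k l =
     (\<Sum>a\<in>index_set N. \<Sum>b\<in>index_set N. A i a k b * B a j b l)"

definition P_matrix :: "nat \<Rightarrow> complex tensor_matrix" where
  "P_matrix N i j k l =
     (\<Sum>a\<in>index_set N. \<Sum>b\<in>index_set N. unit_matrix a b i j * unit_matrix b a k l)"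

definition Q_matrix :: "family \<Rightarrow> nat \<Rightarrow> complex tensor_matrix" where
  "Q_matrix F N i j k l =
     (\<Sum>a\<in>index_set N. \<Sum>b\<in>index_set N.
        theta F a b * unit_matrix a b i j * unit_matrix (- a) (- b) k l)"

text \<open>All series are Laurent series in inverse variables: the formal variable \<open>fls_X\<close> is
  \<open>1/u\<close>, so \<open>fls_X_inv\<close> is \<open>u\<close>.  A series in two variables \<open>u\<close>, \<open>v\<close> is a Laurent series in
  \<open>1/u\<close> whose coefficients are Laurent series in \<open>1/v\<close>; over the complex numbers these form a
  field, where rational functions in \<open>u - v\<close> are expanded in powers of \<open>v/u\<close>.\<close>

definition R_matrix :: "family \<Rightarrow> nat \<Rightarrow> complex fls fls tensor_matrix" where
  "R_matrix F N i j k l =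
     (let u = fls_X_inv; v = fls_const fls_X_inv;
          const = (\<lambda>c. fls_const (fls_const c))
      in (if i = j \<and> k = l then 1 else 0)
         - const (P_matrix N i j k l) / (u - v)
         + const (Q_matrix F N i j k l) / (u - v - const (kappa F N)))"

definition fls_map :: "('a::zero \<Rightarrow> 'b::zero) \<Rightarrow> 'a fls \<Rightarrow> 'b fls" where
  "fls_map f x = Abs_fls (\<lambda>n. f (fls_nth x n))"

text \<open>The generator \<open>(i, j, r)\<close> stands for \<open>t\<^bsub>ij\<^esub>\<^bsup>(r)\<^esup>\<close>.\<close>

type_synonym gen = "int \<times> int \<times> nat"

definition T1_matrix :: "gen free fls fls tensor_matrix" where
  "T1_matrix i j k l =
     (if k = l then fps_to_fls (Abs_fps (\<lambda>r. fls_const (letter (i, j, r)))) else 0)"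

definition T2_matrix :: "gen free fls fls tensor_matrix" where
  "T2_matrix i j k l =
     (if i = j then fls_const (fps_to_fls (Abs_fps (\<lambda>r. letter (k, l, r)))) else 0)"

definition RTT_defect :: "family \<Rightarrow> nat \<Rightarrow> gen free fls fls tensor_matrix" where
  "RTT_defect F N i j k l =
     (let R = (\<lambda>i j k l. fls_map (fls_map scalar) (R_matrix F N i j k l));
          mul = tensor_matrix_mult N
      in mul (mul R T1_matrix) T2_matrix i j k l - mul (mul T2_matrix T1_matrix) R i j k l)"

definition generators :: "nat \<Rightarrow> gen set" where
  "generators N = index_set N \<times> index_set N \<times> UNIV"

definition yangian_relations :: "family \<Rightarrow> nat \<Rightarrow> gen free set" where
  "yangian_relations F N =
     {letter (i, j, 0) - (if i = j then 1 else 0) |i j. i \<in> index_set N \<and> j \<in> index_set N} \<union>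
     {fls_nth (fls_nth (RTT_defect F N i j k l) m) n |i j k l m n.
        i \<in> index_set N \<and> j \<in> index_set N \<and> k \<in> index_set N \<and> l \<in> index_set N}"

definition yangian_ideal :: "family \<Rightarrow> nat \<Rightarrow> gen free set" where
  "yangian_ideal F N = Idl\<^bsub>free_alg (generators N)\<^esub> (yangian_relations F N)"

definition X_alg :: "family \<Rightarrow> nat \<Rightarrow> (complex, gen free set) module" where
  "X_alg F N = quotient_alg (free_alg (generators N)) (yangian_ideal F N)"

definition X_proj :: "family \<Rightarrow> nat \<Rightarrow> gen free \<Rightarrow> gen free set" where
  "X_proj F N p = yangian_ideal F N +>\<^bsub>free_alg (generators N)\<^esub> p"

definition XX_alg ::
    "family \<Rightarrow> nat \<Rightarrow> (complex, ((gen free set \<times> gen free set) \<Rightarrow>\<^sub>0 complex) set) module" where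
  "XX_alg F N = tensor_alg (X_alg F N) (X_alg F N)"

text \<open>The coefficient of \<open>u\<^bsup>-r\<^esup>\<close> in the coproduct of \<open>t\<^bsub>ij\<^esub>(u)\<close>.\<close>

definition coproduct_gen ::
    "family \<Rightarrow> nat \<Rightarrow> gen \<Rightarrow> ((gen free set \<times> gen free set) \<Rightarrow>\<^sub>0 complex) set" where
  "coproduct_gen F N = (\<lambda>(i, j, r).
     \<Oplus>\<^bsub>XX_alg F N\<^esub>k\<in>index_set N. \<Oplus>\<^bsub>XX_alg F N\<^esub>s\<in>{..r}.
       pure_tensor (X_alg F N) (X_alg F N)
         (X_proj F N (letter (i, k, s))) (X_proj F N (letter (k, j, r - s))))"

text \<open>The homomorphism on the free algebra factors through the quotient, that is, it is constant on
  each coset \<open>x\<close>.\<close>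

definition coproduct ::
    "family \<Rightarrow> nat \<Rightarrow> gen free set \<Rightarrow> ((gen free set \<times> gen free set) \<Rightarrow>\<^sub>0 complex) set" where
  "coproduct F N x = the_elem (free_lift (XX_alg F N) (coproduct_gen F N) ` x)"


section \<open>Twisted Yangians\<close>

text \<open>\<open>BCD0\<close>, \<open>CI\<close> and \<open>DIII\<close> carry the size \<open>N\<close>; \<open>CII\<close> and \<open>BDI\<close> carry \<open>p\<close> and \<open>q\<close>.\<close>

datatype symmetric_pair = BCD0 family nat | CI nat | DIII nat | CII nat nat | BDI nat nat

fun pair_family :: "symmetric_pair \<Rightarrow> family" where
  "pair_family (BCD0 F N) = F"
| "pair_family (CI N) = Symplectic"
| "pair_family (DIII N) = Orthogonal"
| "pair_family (CII p q) = Symplectic"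
| "pair_family (BDI p q) = Orthogonal"

fun pair_size :: "symmetric_pair \<Rightarrow> nat" where
  "pair_size (BCD0 F N) = N"
| "pair_size (CI N) = N"
| "pair_size (DIII N) = N"
| "pair_size (CII p q) = p + q"
| "pair_size (BDI p q) = p + q"

text \<open>The condition \<open>N \<ge> 2\<close> expresses \<open>n \<ge> 1\<close> and is automatic in the last two cases.\<close>

fun admissible :: "symmetric_pair \<Rightarrow> bool" where
  "admissible (BCD0 F N) \<longleftrightarrow> N \<ge> 2 \<and> (F = Symplectic \<longrightarrow> even N)"
| "admissible (CI N) \<longleftrightarrow> N \<ge> 2 \<and> even N"
| "admissible (DIII N) \<longleftrightarrow> N \<ge> 2 \<and> even N"
| "admissible (CII p q) \<longleftrightarrow> even p \<and> even q \<and> p \<ge> q \<and> q > 0"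
| "admissible (BDI p q) \<longleftrightarrow> q > 0 \<and> (if odd (p + q) then p > q else p \<ge> q)"

fun G_matrix :: "symmetric_pair \<Rightarrow> int \<Rightarrow> int \<Rightarrow> complex" where
  "G_matrix (BCD0 F N) a b = (\<Sum>i\<in>index_set N. unit_matrix i i a b)"
| "G_matrix (CI N) a b =
     (\<Sum>i=1..int N div 2. unit_matrix i i a b - unit_matrix (-i) (-i) a b)"
| "G_matrix (DIII N) a b =
     (\<Sum>i=1..int N div 2. unit_matrix i i a b - unit_matrix (-i) (-i) a b)"
| "G_matrix (CII p q) a b =
     - (\<Sum>i=1..int q div 2. unit_matrix i i a b + unit_matrix (-i) (-i) a b)
     + (\<Sum>i=int q div 2 + 1..int (p + q) div 2. unit_matrix i i a b + unit_matrix (-i) (-i) a b)"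
| "G_matrix (BDI p q) a b =
     (if even (p + q) then
        (\<Sum>i=1..(int p - int q) div 2. unit_matrix i i a b + unit_matrix (-i) (-i) a b)
        + (\<Sum>i=(int p - int q) div 2 + 1..int (p + q) div 2.
             unit_matrix (-i) i a b + unit_matrix i (-i) a b)
      else
        (\<Sum>i=- ((int p - int q - 1) div 2)..(int p - int q - 1) div 2. unit_matrix i i a b)
        + (\<Sum>i=(int p - int q + 1) div 2..(int (p + q) - 1) div 2.
             unit_matrix (-i) i a b + unit_matrix i (-i) a b))"

definition rational_G :: "nat \<Rightarrow> nat \<Rightarrow> (int \<Rightarrow> int \<Rightarrow> complex) \<Rightarrow> int \<Rightarrow> int \<Rightarrow> complex fls" where
  "rational_G p q G a b =
     (let u = fls_X_inv; c = fls_const (4 / (of_nat p - of_nat q))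
      in ((if a = b then 1 else 0) - c * u * fls_const (G a b)) / (1 - c * u))"

fun G_series :: "symmetric_pair \<Rightarrow> int \<Rightarrow> int \<Rightarrow> complex fls" where
  "G_series (CII p q) a b =
     (if p > q then rational_G p q (G_matrix (CII p q)) a b
      else fls_const (G_matrix (CII p q) a b))"
| "G_series (BDI p q) a b =
     (if p > q then rational_G p q (G_matrix (BDI p q)) a b
      else fls_const (G_matrix (BDI p q) a b))"
| "G_series L a b = fls_const (G_matrix L a b)"

text \<open>The expansion in \<open>1/u\<close> of \<open>t\<^bsub>ij\<^esub>(x)\<close>, for an argument \<open>x\<close> of the form \<open>u + c\<close> or
  \<open>- u + c\<close>: the series \<open>inverse x ^ r\<close> starts in degree \<open>r\<close>, so only the terms \<open>r \<le> n\<close>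
  contribute to the coefficient of \<open>u\<^bsup>-n\<^esup>\<close>.\<close>

definition t_at :: "complex fls \<Rightarrow> int \<Rightarrow> int \<Rightarrow> gen free fls" where
  "t_at x i j =
     fps_to_fls (Abs_fps (\<lambda>n. \<Sum>r\<le>n. scalar (fls_nth (inverse x ^ r) (int n)) * letter (i, j, r)))"

definition transp_at :: "family \<Rightarrow> nat \<Rightarrow> complex fls \<Rightarrow> int \<Rightarrow> int \<Rightarrow> gen free fls" where
  "transp_at F N x k l =
     (\<Sum>i\<in>index_set N. \<Sum>j\<in>index_set N.
        fls_const (scalar (theta F i j)) * unit_matrix (- j) (- i) k l * t_at x i j)"

definition S_series :: "symmetric_pair \<Rightarrow> int \<Rightarrow> int \<Rightarrow> gen free fls" where
  "S_series L i j =
     (let F = pair_family L; N = pair_size L; u = fls_X_inv; h = fls_const (kappa F N / 2)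
      in \<Sum>a\<in>index_set N. \<Sum>b\<in>index_set N.
           t_at (u - h) i a * fls_map scalar (G_series L a b) * transp_at F N (- u + h) b j)"

definition twisted_yangian :: "symmetric_pair \<Rightarrow> gen free set set" where
  "twisted_yangian L =
     (let F = pair_family L; N = pair_size L
      in generated_subalg (X_alg F N)
           {X_proj F N (fls_nth (S_series L i j) n) |i j n. i \<in> index_set N \<and> j \<in> index_set N})"

end

theory Submission
  imports Defs "HOL-Library.Product_Plus"
begin

text \<open>
  Write \<open>T\<^sub>1\<close> and \<open>T\<^sub>2\<close> for the matrices with entries \<open>t\<^bsub>ij\<^esub>(u) \<otimes> 1\<close> and \<open>1 \<otimes> t\<^bsub>ij\<^esub>(u)\<close>, and
  likewise for other matrices.  The coproduct sends \<open>T\<close> to the matrix product \<open>T\<^sub>1 T\<^sub>2\<close>.  The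
  transposition reverses products of matrices whose entries commute, and it is here that
  \<open>\<theta>\<^bsub>ik\<^esub> \<theta>\<^bsub>kj\<^esub> = \<theta>\<^bsub>ij\<^esub>\<close> is needed; so \<open>T\<^sup>t\<close> is sent to \<open>T\<^sup>t\<^sub>2 T\<^sup>t\<^sub>1\<close>.  Since the entries of \<open>\<G>(u)\<close>
  are scalars, the image of \<open>S(u) = T(u - \<kappa>/2) \<G>(u) T\<^sup>t(- u + \<kappa>/2)\<close> is
  \<open>T\<^sub>1(u - \<kappa>/2) S\<^sub>2(u) T\<^sup>t\<^sub>1(- u + \<kappa>/2)\<close> (\<open>comult_S_series\<close>).  An entry of that product is a sum of series
  whose coefficients have the form \<open>p q \<otimes> s\<close>, where \<open>s\<close> is a coefficient of an entry of \<open>S(u)\<close>.  So the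
  generators of the twisted Yangian \<open>Y\<close> are sent into \<open>X \<otimes> Y\<close>.  As \<open>X \<otimes> Y\<close> is a subalgebra
  (\<open>subalg_tensor_subspace\<close>) and the coproduct is a homomorphism (\<open>coproduct_hom\<close>), the same holds for
  all of \<open>Y\<close>.

  That the coproduct is a homomorphism includes that it is well defined on the quotient \<open>X\<close> of the free
  algebra, i.e. that it respects the defining relations.  For the RTT relation, let \<open>T(u)\<close>
  and \<open>T(v)\<close> act in the first and the second factor of the square of the matrix algebra.  The entries of
  \<open>T\<^sub>2(u)\<close> commute with those of \<open>T\<^sub>1(v)\<close>, so that
  \<open>R T\<^sub>1(u) T\<^sub>2(u) T\<^sub>1(v) T\<^sub>2(v) = (R T\<^sub>1(u) T\<^sub>1(v)) T\<^sub>2(u) T\<^sub>2(v)\<close>, and \<open>R\<close> can be moved to the right past one pair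
  after the other.  More precisely, the defect of the relation for the product is a combination of the
  defects for \<open>T\<^sub>1\<close> and \<open>T\<^sub>2\<close> (\<open>comult_RTT_defect\<close>).

  These matrix computations take place over a ring that is a type: the tensor square of the
  free algebra is the monoid algebra of pairs of words, and \<open>comult\<close> is the coproduct with values there.
  The homomorphism \<open>tensor_proj\<close> from that ring onto \<open>X \<otimes> X\<close> then carries the results over.
\<close>

section \<open>Unital algebras and their subalgebras\<close>

locale unital_algebra = ring A for A :: "(complex, 'a) module" (structure) +
  assumes scale_closed [simp, intro]: "a \<in> carrier A \<Longrightarrow> c \<odot> a \<in> carrier A"
    and scale_add_left: "a \<in> carrier A \<Longrightarrow> (c + d) \<odot> a = c \<odot> a \<oplus> d \<odot> a"
    and scale_add_right: "a \<in> carrier A \<Longrightarrow> b \<in> carrier A \<Longrightarrow> c \<odot> (a \<oplus> b) = c \<odot> a \<oplus> c \<odot> b"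
    and scale_scale: "a \<in> carrier A \<Longrightarrow> (c * d) \<odot> a = c \<odot> (d \<odot> a)"
    and scale_one [simp]: "a \<in> carrier A \<Longrightarrow> 1 \<odot> a = a"
    and scale_mult_left: "a \<in> carrier A \<Longrightarrow> b \<in> carrier A \<Longrightarrow> (c \<odot> a) \<otimes> b = c \<odot> (a \<otimes> b)"
    and scale_mult_right: "a \<in> carrier A \<Longrightarrow> b \<in> carrier A \<Longrightarrow> a \<otimes> (c \<odot> b) = c \<odot> (a \<otimes> b)"

lemma cring_complex_ring: "cring complex_ring"
proof (rule cringI)
  show "abelian_group complex_ring"
  proof (rule abelian_groupI)
    fix x :: complex
    show "\<exists>y\<in>carrier complex_ring. y \<oplus>\<^bsub>complex_ring\<^esub> x = \<zero>\<^bsub>complex_ring\<^esub>"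
      by (rule bexI[of _ "- x"]) (auto simp: complex_ring_def)
  qed (auto simp: complex_ring_def)
  show "comm_monoid complex_ring"
    by (rule comm_monoidI) (auto simp: complex_ring_def)
qed (auto simp: complex_ring_def algebra_simps)

context unital_algebra
begin

lemma module_complex_ring: "module complex_ring A"
  using cring_complex_ring
  by (rule moduleI)
    (auto simp: complex_ring_def scale_add_left scale_add_right scale_scale abelian_group_axioms)

lemma scale_zero_left [simp]: "a \<in> carrier A \<Longrightarrow> 0 \<odot> a = \<zero>"
  using module.smult_l_null[OF module_complex_ring] by (simp add: complex_ring_def)

lemma scale_zero_right [simp]: "c \<odot> \<zero> = \<zero>"
  using module.smult_r_null[OF module_complex_ring] by (simp add: complex_ring_def)

lemma scale_minus_one: "a \<in> carrier A \<Longrightarrow> (-1) \<odot> a = \<ominus> a"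
  using scale_add_left[of a "-1" 1] by (simp add: minus_equality)

lemma submodule_iff:
  "submodule H complex_ring A \<longleftrightarrow>
     H \<subseteq> carrier A \<and> \<zero> \<in> H \<and> (\<forall>a\<in>H. \<forall>b\<in>H. a \<oplus> b \<in> H) \<and> (\<forall>c. \<forall>a\<in>H. c \<odot> a \<in> H)"
    (is "?lhs \<longleftrightarrow> ?rhs")
proof
  assume ?lhs
  then interpret submodule H complex_ring A .
  show ?rhs
    using subset one_closed m_closed smult_closed by (auto simp: complex_ring_def)
next
  assume rhs: ?rhs
  show ?lhs
  proof (rule module.submoduleI[OF module_complex_ring])
    fix a assume "a \<in> H"
    with rhs show "\<ominus> a \<in> H" by (metis scale_minus_one subsetD)
  qed (use rhs in auto)
qed

lemma subalg_iff:
  "subalg H A \<longleftrightarrow> submodule H complex_ring A \<and> \<one> \<in> H \<and> (\<forall>a\<in>H. \<forall>b\<in>H. a \<otimes> b \<in> H)"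
    (is "?lhs \<longleftrightarrow> ?rhs")
proof
  assume ?lhs
  then show ?rhs by (auto simp: subalg_def dest: subringE)
next
  assume rhs: ?rhs
  have "subring H A"
  proof (rule subringI)
    fix a assume "a \<in> H"
    with rhs show "\<ominus> a \<in> H" by (metis scale_minus_one submodule_iff subsetD)
  qed (use rhs in \<open>auto simp: submodule_iff\<close>)
  with rhs show ?lhs by (simp add: subalg_def)
qed

lemma submodule_carrier: "submodule (carrier A) complex_ring A"
  by (simp add: submodule_iff)

lemma subalg_carrier: "subalg (carrier A) A"
  by (simp add: subalg_iff submodule_carrier)

lemma subalg_Inter:
  assumes "\<H> \<noteq> {}" "\<And>H. H \<in> \<H> \<Longrightarrow> subalg H A"
  shows "subalg (\<Inter>\<H>) A"
  using assms by (fastforce simp: subalg_iff submodule_iff)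

lemma submodule_linear_span:
  assumes "S \<subseteq> carrier A"
  shows "submodule (linear_span A S) complex_ring A"
proof -
  have "carrier A \<in> {H. submodule H complex_ring A \<and> S \<subseteq> H}"
    using assms submodule_carrier by simp
  then have "linear_span A S \<subseteq> carrier A" unfolding linear_span_def by blast
  moreover have "\<zero> \<in> linear_span A S \<and>
      (\<forall>a\<in>linear_span A S. \<forall>b\<in>linear_span A S. a \<oplus> b \<in> linear_span A S) \<and>
      (\<forall>c. \<forall>a\<in>linear_span A S. c \<odot> a \<in> linear_span A S)"
    unfolding linear_span_def submodule_iff by auto
  ultimately show ?thesis by (simp add: submodule_iff)
qed

lemma subset_linear_span: "S \<subseteq> linear_span A S"
  by (auto simp: linear_span_def)

lemma linear_span_minimal:
  "submodule H complex_ring A \<Longrightarrow> S \<subseteq> H \<Longrightarrow> linear_span A S \<subseteq> H"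
  by (auto simp: linear_span_def)

lemma subalg_generated_subalg:
  assumes "S \<subseteq> carrier A"
  shows "subalg (generated_subalg A S) A"
  unfolding generated_subalg_def
  by (rule subalg_Inter) (use assms subalg_carrier in auto)

lemma subset_generated_subalg: "S \<subseteq> generated_subalg A S"
  by (auto simp: generated_subalg_def)

lemma generated_subalg_minimal:
  "subalg H A \<Longrightarrow> S \<subseteq> H \<Longrightarrow> generated_subalg A S \<subseteq> H"
  by (auto simp: generated_subalg_def)

lemma submodule_left_mult_vimage:
  assumes "submodule V complex_ring A" "a \<in> carrier A"
  shows "submodule {b \<in> carrier A. a \<otimes> b \<in> V} complex_ring A"
  using assms by (auto simp: submodule_iff r_distr scale_mult_right)

lemma submodule_right_mult_vimage:
  assumes "submodule V complex_ring A" "b \<in> carrier A"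
  shows "submodule {a \<in> carrier A. a \<otimes> b \<in> V} complex_ring A"
  using assms by (auto simp: submodule_iff l_distr scale_mult_left)

text \<open>Bilinearity of the product extends closedness from the spanning set to the span in two steps, one
  factor at a time.\<close>

lemma subalg_linear_span:
  assumes S: "S \<subseteq> carrier A" and one: "\<one> \<in> S"
    and mult: "\<And>a b. a \<in> S \<Longrightarrow> b \<in> S \<Longrightarrow> a \<otimes> b \<in> S"
  shows "subalg (linear_span A S) A"
proof -
  let ?V = "linear_span A S"
  have V: "submodule ?V complex_ring A" by (rule submodule_linear_span[OF S])
  have left: "a \<otimes> b \<in> ?V" if a: "a \<in> S" and b: "b \<in> ?V" for a b
    using linear_span_minimal[OF submodule_left_mult_vimage[OF V, of a], of S]
      S a b mult subset_linear_span[of S] by blast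
  have "a \<otimes> b \<in> ?V" if a: "a \<in> ?V" and b: "b \<in> ?V" for a b
  proof -
    have "b \<in> carrier A" using V b by (auto simp: submodule_iff)
    then show ?thesis
      using linear_span_minimal[OF submodule_right_mult_vimage[OF V, of b], of S]
        S a b left by blast
  qed
  then show ?thesis
    using V one subset_linear_span by (auto simp: subalg_iff)
qed

text \<open>It suffices to multiply the spanning set \<open>S\<close> by a set \<open>G\<close> that spans the whole algebra.  This is how
  the span of the bilinear relations is seen to be an ideal.\<close>

lemma ideal_linear_span:
  assumes S: "S \<subseteq> carrier A" and G: "G \<subseteq> carrier A" "carrier A \<subseteq> linear_span A G"
    and mult: "\<And>g s. g \<in> G \<Longrightarrow> s \<in> S \<Longrightarrow> g \<otimes> s \<in> S \<and> s \<otimes> g \<in> S"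
  shows "ideal (linear_span A S) A"
proof (rule idealI)
  let ?V = "linear_span A S"
  have V: "submodule ?V complex_ring A" by (rule submodule_linear_span[OF S])
  show "ring A" by (rule ring_axioms)
  show "subgroup ?V (add_monoid A)" using V by (rule submodule.axioms(1))
  fix t r assume t: "t \<in> ?V" and r: "r \<in> carrier A"
  have tA: "t \<in> carrier A" using t V by (auto simp: submodule_iff)
  have "g \<otimes> t \<in> ?V \<and> t \<otimes> g \<in> ?V" if "g \<in> G" for g
    using that t mult S G subset_linear_span[of S]
      linear_span_minimal[OF submodule_left_mult_vimage[OF V, of g], of S]
      linear_span_minimal[OF submodule_right_mult_vimage[OF V, of g], of S]
    by blast
  then show "r \<otimes> t \<in> ?V" "t \<otimes> r \<in> ?V"
    using r G linear_span_minimal[OF submodule_right_mult_vimage[OF V tA], of G]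
      linear_span_minimal[OF submodule_left_mult_vimage[OF V tA], of G]
    by blast+
qed

text \<open>Ring-theoretic ideals are automatically subspaces, because \<open>c \<odot> a = (c \<odot> \<one>) \<otimes> a\<close>.\<close>

lemma ideal_scale_closed:
  assumes "ideal J A" "a \<in> J"
  shows "c \<odot> a \<in> J"
proof -
  interpret ideal J A by fact
  have "c \<odot> a = (c \<odot> \<one>) \<otimes> a" using assms(2) by (simp add: scale_mult_left)
  then show ?thesis using assms(2) by (simp add: I_l_closed)
qed

end

locale unital_algebra_hom = A: unital_algebra A + B: unital_algebra B
  for A :: "(complex, 'a) module" and B :: "(complex, 'b) module" +
  fixes h
  assumes hom_closed [simp]: "a \<in> carrier A \<Longrightarrow> h a \<in> carrier B"
    and hom_add [simp]: "a \<in> carrier A \<Longrightarrow> b \<in> carrier A \<Longrightarrow> h (a \<oplus>\<^bsub>A\<^esub> b) = h a \<oplus>\<^bsub>B\<^esub> h b"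
    and hom_mult [simp]: "a \<in> carrier A \<Longrightarrow> b \<in> carrier A \<Longrightarrow> h (a \<otimes>\<^bsub>A\<^esub> b) = h a \<otimes>\<^bsub>B\<^esub> h b"
    and hom_one [simp]: "h \<one>\<^bsub>A\<^esub> = \<one>\<^bsub>B\<^esub>"
    and hom_scale [simp]: "a \<in> carrier A \<Longrightarrow> h (c \<odot>\<^bsub>A\<^esub> a) = c \<odot>\<^bsub>B\<^esub> h a"
begin

lemma hom_zero [simp]: "h \<zero>\<^bsub>A\<^esub> = \<zero>\<^bsub>B\<^esub>"
  using hom_scale[of "\<zero>\<^bsub>A\<^esub>" 0] by simp

lemma ring_hom: "ring_hom_ring A B h"
  by (rule ring_hom_ringI) (auto simp: A.ring_axioms B.ring_axioms)

lemma hom_finsum: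
  "f \<in> I \<rightarrow> carrier A \<Longrightarrow> h (\<Oplus>\<^bsub>A\<^esub>i\<in>I. f i) = (\<Oplus>\<^bsub>B\<^esub>i\<in>I. h (f i))"
proof (induction I rule: infinite_finite_induct)
  case (insert i I)
  then have f: "f \<in> I \<rightarrow> carrier A" "f i \<in> carrier A" by auto
  then have "(\<lambda>i. h (f i)) \<in> I \<rightarrow> carrier B" by (simp add: Pi_iff)
  with insert f show ?case by (simp add: A.finsum_insert B.finsum_insert)
qed simp_all

lemma submodule_vimage:
  assumes "submodule V complex_ring B"
  shows "submodule {a \<in> carrier A. h a \<in> V} complex_ring A"
  using assms by (auto simp: A.submodule_iff B.submodule_iff)

lemma subalg_vimage:
  assumes "subalg V B"
  shows "subalg {a \<in> carrier A. h a \<in> V} A"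
  using assms submodule_vimage by (auto simp: A.subalg_iff B.subalg_iff)

lemma ideal_kernel: "ideal {a \<in> carrier A. h a = \<zero>\<^bsub>B\<^esub>} A"
  using ring_hom_ring.kernel_is_ideal[OF ring_hom] by (simp add: a_kernel_def')

end

lemma unital_algebra_hom_comp:
  assumes "unital_algebra_hom A B g" "unital_algebra_hom B C h"
  shows "unital_algebra_hom A C (\<lambda>a. h (g a))"
proof -
  interpret g: unital_algebra_hom A B g by fact
  interpret h: unital_algebra_hom B C h by fact
  show ?thesis by unfold_locales auto
qed

section \<open>Quotient algebras\<close>

lemma ring_quotient_alg:
  assumes "ideal J A"
  shows "ring (quotient_alg A J)"
proof -
  interpret Q: ring "A Quot J" using assms by (rule ideal.quotient_is_ring)
  show ?thesis
  proof (rule ringI)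
    show "abelian_group (quotient_alg A J)"
    proof (rule abelian_groupI)
      fix x assume "x \<in> carrier (quotient_alg A J)"
      then show "\<exists>y\<in>carrier (quotient_alg A J).
          y \<oplus>\<^bsub>quotient_alg A J\<^esub> x = \<zero>\<^bsub>quotient_alg A J\<^esub>"
        by (intro bexI[of _ "\<ominus>\<^bsub>A Quot J\<^esub> x"]) (auto simp: quotient_alg_def Q.l_neg)
    qed (simp_all add: quotient_alg_def Q.a_ac)
    show "Group.monoid (quotient_alg A J)"
      by (rule monoidI) (auto simp: quotient_alg_def Q.m_assoc)
  qed (auto simp: quotient_alg_def Q.l_distr Q.r_distr)
qed

lemma carrier_quotient_alg: "carrier (quotient_alg A J) = (\<lambda>a. J +>\<^bsub>A\<^esub> a) ` carrier A"
  by (auto simp: quotient_alg_def FactRing_def A_RCOSETS_defs a_r_coset_def)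

context unital_algebra
begin

context
  fixes J assumes J: "ideal J A"
begin

interpretation J: ideal J A by (rule J)

lemma coset_eq_iff:
  assumes "a \<in> carrier A" "b \<in> carrier A"
  shows "J +> a = J +> b \<longleftrightarrow> a \<ominus> b \<in> J"
  using quotient_eq_iff_same_a_r_cos[OF J] assms by simp

lemma scale_quotient_coset:
  assumes a: "a \<in> carrier A"
  shows "c \<odot>\<^bsub>quotient_alg A J\<^esub> (J +> a) = J +> (c \<odot> a)"
proof -
  have "J +> (c \<odot> b) = J +> (c \<odot> a)" if b: "b \<in> J +> a" for b
  proof -
    from b obtain j where j: "j \<in> J" and b_eq: "b = j \<oplus> a"
      by (auto simp: a_r_coset_def')
    have jc: "j \<in> carrier A" using j by simp
    have "c \<odot> b \<ominus> c \<odot> a = c \<odot> j"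
      using a jc by (simp add: b_eq scale_add_right a_assoc minus_eq r_neg)
    then show ?thesis
      using a jc b_eq coset_eq_iff ideal_scale_closed[OF J j] by simp
  qed
  moreover have "J +> a \<noteq> {}" using J.a_rcos_self[OF a] by blast
  ultimately have "(\<Union>b\<in>J +> a. J +> (c \<odot> b)) = J +> (c \<odot> a)" by blast
  then show ?thesis by (simp add: quotient_alg_def)
qed

lemma quotient_ops:
  assumes "a \<in> carrier A" "b \<in> carrier A"
  shows "(J +> a) \<oplus>\<^bsub>quotient_alg A J\<^esub> (J +> b) = J +> (a \<oplus> b)"
    and "(J +> a) \<otimes>\<^bsub>quotient_alg A J\<^esub> (J +> b) = J +> (a \<otimes> b)"
  using assms by (simp_all add: quotient_alg_def FactRing_def J.a_rcos_sum J.rcoset_mult_add)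

lemma coset_in_carrier: "a \<in> carrier A \<Longrightarrow> J +> a \<in> carrier (quotient_alg A J)"
  by (simp add: carrier_quotient_alg)

lemma in_quotient_algE:
  assumes "x \<in> carrier (quotient_alg A J)"
  obtains a where "x = J +> a" "a \<in> carrier A"
  using assms by (auto simp: carrier_quotient_alg)

lemma unital_algebra_quotient_alg: "unital_algebra (quotient_alg A J)"
proof (intro unital_algebra.intro unital_algebra_axioms.intro)
  show "ring (quotient_alg A J)" using J by (rule ring_quotient_alg)
qed (elim in_quotient_algE;
    simp add: scale_quotient_coset quotient_ops coset_in_carrier scale_add_left scale_add_right
      scale_scale scale_mult_left scale_mult_right)+

lemma coset_hom: "unital_algebra_hom A (quotient_alg A J) (\<lambda>a. J +> a)"
proof (intro unital_algebra_hom.intro unital_algebra_hom_axioms.intro)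
  show "J +> \<one> = \<one>\<^bsub>quotient_alg A J\<^esub>"
    by (simp add: quotient_alg_def FactRing_def)
qed (simp_all add: unital_algebra_axioms unital_algebra_quotient_alg scale_quotient_coset
    quotient_ops coset_in_carrier)

lemma coset_eq_zero_iff:
  assumes "a \<in> carrier A"
  shows "J +> a = \<zero>\<^bsub>quotient_alg A J\<^esub> \<longleftrightarrow> a \<in> J"
proof -
  have "\<zero>\<^bsub>quotient_alg A J\<^esub> = J +> \<zero>"
    by (simp add: quotient_alg_def FactRing_def a_coset_add_zero J.a_subset)
  then show ?thesis using assms by (simp add: coset_eq_iff minus_eq)
qed

end

end

section \<open>Linear extension\<close>

definition scl :: "complex \<Rightarrow> ('k \<Rightarrow>\<^sub>0 complex) \<Rightarrow> ('k \<Rightarrow>\<^sub>0 complex)" where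
  "scl c = Poly_Mapping.map ((*) c)"

lemma lookup_scl [simp]: "Poly_Mapping.lookup (scl c p) k = c * Poly_Mapping.lookup p k"
  unfolding scl_def by (simp add: Poly_Mapping.map.rep_eq when_def)

lemma scl_single [simp]: "scl c (Poly_Mapping.single k d) = Poly_Mapping.single k (c * d)"
  by (simp add: scl_def)

lemma scl_zero [simp]: "scl c 0 = 0" "scl 0 p = 0"
  by (rule poly_mapping_eqI; simp)+

lemma scl_one [simp]: "scl 1 p = p"
  by (rule poly_mapping_eqI; simp)

lemma scl_add_right: "scl c (p + q) = scl c p + scl c q"
  by (rule poly_mapping_eqI; simp add: lookup_add algebra_simps)

lemma scl_add_left: "scl (c + d) p = scl c p + scl d p"
  by (rule poly_mapping_eqI; simp add: lookup_add algebra_simps)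

lemma scl_scl [simp]: "scl c (scl d p) = scl (c * d) p"
  by (rule poly_mapping_eqI; simp add: algebra_simps)

lemma scl_sum: "scl c (\<Sum>i\<in>I. f i) = (\<Sum>i\<in>I. scl c (f i))"
  by (rule poly_mapping_eqI; simp add: lookup_sum sum_distrib_left)

lemma uminus_eq_scl: "- p = scl (-1) p" for p :: "'k \<Rightarrow>\<^sub>0 complex"
  by (rule poly_mapping_eqI; simp)

lemma keys_scl: "Poly_Mapping.keys (scl c p) \<subseteq> Poly_Mapping.keys p"
  by (auto simp: in_keys_iff)

lemma keys_scl_closed [simp]: "Poly_Mapping.keys p \<subseteq> S \<Longrightarrow> Poly_Mapping.keys (scl c p) \<subseteq> S"
  using keys_scl[of c p] by blast

lemma keys_add_closed [simp]:
  "Poly_Mapping.keys p \<subseteq> S \<Longrightarrow> Poly_Mapping.keys q \<subseteq> S \<Longrightarrow> Poly_Mapping.keys (p + q) \<subseteq> S"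
  using Poly_Mapping.keys_add[of p q] by blast

lemma single_zero_times: "Poly_Mapping.single 0 c * p = scl c p" for p :: "'m::monoid_add \<Rightarrow>\<^sub>0 complex"
  by (simp add: scl_def mult_map_scale_conv_mult)

definition lin_ext :: "('x \<Rightarrow> ('k \<Rightarrow>\<^sub>0 complex)) \<Rightarrow> ('x \<Rightarrow>\<^sub>0 complex) \<Rightarrow> ('k \<Rightarrow>\<^sub>0 complex)" where
  "lin_ext f p = (\<Sum>x\<in>Poly_Mapping.keys p. scl (Poly_Mapping.lookup p x) (f x))"

lemma lin_ext_superset:
  assumes "finite S" "Poly_Mapping.keys p \<subseteq> S"
  shows "lin_ext f p = (\<Sum>x\<in>S. scl (Poly_Mapping.lookup p x) (f x))"
  unfolding lin_ext_def by (rule sum.mono_neutral_left) (use assms in \<open>auto simp: in_keys_iff\<close>)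

lemma lin_ext_zero [simp]: "lin_ext f 0 = 0"
  by (simp add: lin_ext_def)

lemma lin_ext_add: "lin_ext f (p + q) = lin_ext f p + lin_ext f q"
proof -
  let ?S = "Poly_Mapping.keys p \<union> Poly_Mapping.keys q"
  have "Poly_Mapping.keys (p + q) \<subseteq> ?S" by (rule Poly_Mapping.keys_add)
  then show ?thesis
    by (simp add: lin_ext_superset[of ?S] lookup_add scl_add_left sum.distrib)
qed

lemma lin_ext_scl: "lin_ext f (scl c p) = scl c (lin_ext f p)"
  by (simp add: lin_ext_superset[OF _ keys_scl] lin_ext_def[of f p] scl_sum)

lemma lin_ext_sum: "lin_ext f (\<Sum>i\<in>I. p i) = (\<Sum>i\<in>I. lin_ext f (p i))"
  by (induction I rule: infinite_finite_induct) (simp_all add: lin_ext_add)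

lemma lin_ext_single [simp]: "lin_ext f (Poly_Mapping.single x c) = scl c (f x)"
  by (simp add: lin_ext_superset[of "{x}"])

lemma lin_ext_cong:
  "(\<And>x. x \<in> Poly_Mapping.keys p \<Longrightarrow> f x = g x) \<Longrightarrow> lin_ext f p = lin_ext g p"
  by (simp add: lin_ext_def)

lemma lin_ext_lin_ext: "lin_ext f (lin_ext g p) = lin_ext (\<lambda>x. lin_ext f (g x)) p"
  by (simp add: lin_ext_def[of g] lin_ext_def[of _ p] lin_ext_sum lin_ext_scl)

lemma lin_ext_fun_add: "lin_ext (\<lambda>x. f x + g x) p = lin_ext f p + lin_ext g p"
  by (simp add: lin_ext_def scl_add_right sum.distrib)

lemma lin_ext_fun_scl: "lin_ext (\<lambda>x. scl c (f x)) p = scl c (lin_ext f p)"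
  by (simp add: lin_ext_def scl_sum mult.commute)

lemma lin_ext_basis [simp]: "lin_ext (\<lambda>x. Poly_Mapping.single x 1) p = p"
  by (rule poly_mapping_eqI)
    (simp add: lin_ext_def lookup_sum lookup_single when_def in_keys_iff sum.delta)

lemma keys_lin_ext:
  "Poly_Mapping.keys (lin_ext f p) \<subseteq> (\<Union>x\<in>Poly_Mapping.keys p. Poly_Mapping.keys (f x))"
proof -
  have "Poly_Mapping.keys (lin_ext f p) \<subseteq>
      (\<Union>x\<in>Poly_Mapping.keys p. Poly_Mapping.keys (scl (Poly_Mapping.lookup p x) (f x)))"
    unfolding lin_ext_def by (rule keys_sum)
  also have "\<dots> \<subseteq> (\<Union>x\<in>Poly_Mapping.keys p. Poly_Mapping.keys (f x))"
    by (rule UN_mono) simp_all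
  finally show ?thesis .
qed

text \<open>Linear maps are determined by their values on a basis; this form of the principle applies to
  monoid algebras and to \<open>pair_alg\<close> alike.\<close>

lemma keys_span_induct [consumes 1, case_names zero single scale add]:
  assumes "Poly_Mapping.keys p \<subseteq> S"
    and zero: "Q 0" and single: "\<And>x. x \<in> S \<Longrightarrow> Q (Poly_Mapping.single x 1)"
    and scale: "\<And>c p. Poly_Mapping.keys p \<subseteq> S \<Longrightarrow> Q p \<Longrightarrow> Q (scl c p)"
    and add: "\<And>p q. Poly_Mapping.keys p \<subseteq> S \<Longrightarrow> Poly_Mapping.keys q \<subseteq> S \<Longrightarrow> Q p \<Longrightarrow> Q q \<Longrightarrow> Q (p + q)"
  shows "Q p"
proof -
  let ?f = "\<lambda>x. scl (Poly_Mapping.lookup p x) (Poly_Mapping.single x 1)"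
  have *: "Q (sum ?f I) \<and> Poly_Mapping.keys (sum ?f I) \<subseteq> S" if "finite I" "I \<subseteq> S" for I
    using that
  proof (induction I rule: finite_induct)
    case (insert x I)
    then have "Poly_Mapping.keys (Poly_Mapping.single x (1::complex)) \<subseteq> S" by simp
    with insert show ?case
      using single[of x] scale[of "Poly_Mapping.single x 1"] add[of "?f x" "sum ?f I"] 
      by (simp del: scl_single)
  qed (simp add: zero)
  have "Q (lin_ext (\<lambda>x. Poly_Mapping.single x 1) p)"
    unfolding lin_ext_def by (rule *[THEN conjunct1]) (use assms(1) in auto)
  then show ?thesis by simp
qed

text \<open>With the convolution product in this form, associativity and multiplicativity of linear maps
  reduce to statements about basis elements, through \<open>lin_ext_lin_ext\<close> and \<open>lin_ext_cong\<close>.\<close>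

lemma times_eq_lin_ext:
  "p * q = lin_ext (\<lambda>x. lin_ext (\<lambda>y. Poly_Mapping.single (x + y) 1) q) p"
  for p q :: "'m::monoid_add \<Rightarrow>\<^sub>0 complex"
proof -
  have "p * q = lin_ext (\<lambda>x. Poly_Mapping.single x 1) p * lin_ext (\<lambda>x. Poly_Mapping.single x 1) q"
    by simp
  also have "\<dots> = lin_ext (\<lambda>x. lin_ext (\<lambda>y. Poly_Mapping.single (x + y) 1) q) p"
    unfolding lin_ext_def
    by (simp add: sum_distrib_left sum_distrib_right mult_single scl_sum)
      (rule sum.swap)
  finally show ?thesis .
qed

lemma scl_times_left: "scl c p * q = scl c (p * q)" for p q :: "'m::monoid_add \<Rightarrow>\<^sub>0 complex"
  by (simp add: single_zero_times[symmetric] mult.assoc)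

lemma scl_times_right: "p * scl c q = scl c (p * q)" for p q :: "'m::monoid_add \<Rightarrow>\<^sub>0 complex"
  unfolding times_eq_lin_ext by (simp add: lin_ext_scl lin_ext_fun_scl)

lemma lin_ext_times:
  fixes f :: "'m::monoid_add \<Rightarrow> ('k::monoid_add \<Rightarrow>\<^sub>0 complex)"
  assumes "\<And>x y. f (x + y) = f x * f y"
  shows "lin_ext f (p * q) = lin_ext f p * lin_ext f q"
  by (simp add: times_eq_lin_ext[of p q] lin_ext_lin_ext assms)
    (simp add: lin_ext_def sum_distrib_left sum_distrib_right scl_times_left scl_times_right
      scl_sum sum.swap[of _ "Poly_Mapping.keys q"] mult.commute)

section \<open>Monoid algebras\<close>

definition monoid_alg :: "'m::monoid_add set \<Rightarrow> (complex, 'm \<Rightarrow>\<^sub>0 complex) module" where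
  "monoid_alg S = \<lparr>carrier = {p. Poly_Mapping.keys p \<subseteq> S}, mult = (*), one = 1, zero = 0, add = (+),
     smult = scl\<rparr>"

lemma monoid_alg_simps [simp]:
  "p \<in> carrier (monoid_alg S) \<longleftrightarrow> Poly_Mapping.keys p \<subseteq> S"
  "mult (monoid_alg S) = (*)" "one (monoid_alg S) = 1" "zero (monoid_alg S) = 0"
  "add (monoid_alg S) = (+)" "smult (monoid_alg S) = scl"
  by (simp_all add: monoid_alg_def)

lemma unital_algebra_monoid_alg:
  assumes "0 \<in> S" and closed: "\<And>x y. x \<in> S \<Longrightarrow> y \<in> S \<Longrightarrow> x + y \<in> S"
  shows "unital_algebra (monoid_alg S)"
proof (intro unital_algebra.intro unital_algebra_axioms.intro ringI)
  show "abelian_group (monoid_alg S)"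
  proof (rule abelian_groupI)
    fix x assume "x \<in> carrier (monoid_alg S)"
    then show "\<exists>y\<in>carrier (monoid_alg S). y \<oplus>\<^bsub>monoid_alg S\<^esub> x = \<zero>\<^bsub>monoid_alg S\<^esub>"
      by (intro bexI[of _ "- x"]) auto
  qed (simp_all add: add_ac)
  show "Group.monoid (monoid_alg S)"
  proof (rule monoidI)
    fix x y assume "x \<in> carrier (monoid_alg S)" "y \<in> carrier (monoid_alg S)"
    then show "x \<otimes>\<^bsub>monoid_alg S\<^esub> y \<in> carrier (monoid_alg S)"
      using closed keys_mult[of x y] by (auto simp: subset_iff)
  qed (simp_all add: assms(1) mult.assoc)
qed (simp_all add: ring_distribs scl_add_left scl_add_right scl_times_left scl_times_right)

section \<open>Tensor products\<close>

locale tensor_product = A: unital_algebra A + B: unital_algebra B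
  for A :: "(complex, 'a) module" and B :: "(complex, 'b) module"
begin

abbreviation "P \<equiv> pair_alg A B"
abbreviation "T \<equiv> tensor_null A B"
abbreviation "AB \<equiv> tensor_alg A B"

abbreviation pmult (infixl \<open>\<star>\<close> 70) where
  "x \<star> y \<equiv> (fst x \<otimes>\<^bsub>A\<^esub> fst y, snd x \<otimes>\<^bsub>B\<^esub> snd y)"

lemma pair_alg_simps [simp]:
  "p \<in> carrier P \<longleftrightarrow> Poly_Mapping.keys p \<subseteq> carrier A \<times> carrier B"
  "one P = Poly_Mapping.single (\<one>\<^bsub>A\<^esub>, \<one>\<^bsub>B\<^esub>) 1" "zero P = 0" "add P = (+)"
  "smult P = scl"
  by (simp_all add: pair_alg_def scl_def fun_eq_iff)

lemma pair_mult:
  "p \<otimes>\<^bsub>P\<^esub> q = lin_ext (\<lambda>x. lin_ext (\<lambda>y. Poly_Mapping.single (x \<star> y) 1) q) p"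
  by (simp add: pair_alg_def lin_ext_def scl_sum)

lemma pair_mult_single:
  "Poly_Mapping.single x c \<otimes>\<^bsub>P\<^esub> Poly_Mapping.single y d = Poly_Mapping.single (x \<star> y) (c * d)"
  by (simp add: pair_mult)

lemma pair_mult_linear:
  "(p + p') \<otimes>\<^bsub>P\<^esub> q = p \<otimes>\<^bsub>P\<^esub> q + p' \<otimes>\<^bsub>P\<^esub> q"
  "(p - p') \<otimes>\<^bsub>P\<^esub> q = p \<otimes>\<^bsub>P\<^esub> q - p' \<otimes>\<^bsub>P\<^esub> q"
  "(scl c p) \<otimes>\<^bsub>P\<^esub> q = scl c (p \<otimes>\<^bsub>P\<^esub> q)"
  "p \<otimes>\<^bsub>P\<^esub> (q + q') = p \<otimes>\<^bsub>P\<^esub> q + p \<otimes>\<^bsub>P\<^esub> q'"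
  "p \<otimes>\<^bsub>P\<^esub> (q - q') = p \<otimes>\<^bsub>P\<^esub> q - p \<otimes>\<^bsub>P\<^esub> q'"
  "p \<otimes>\<^bsub>P\<^esub> (scl c q) = scl c (p \<otimes>\<^bsub>P\<^esub> q)"
  by (simp_all only: pair_mult lin_ext_add lin_ext_scl lin_ext_fun_add lin_ext_fun_scl
      diff_conv_add_uminus uminus_eq_scl)

lemma pair_mult_closed:
  assumes "p \<in> carrier P" "q \<in> carrier P"
  shows "p \<otimes>\<^bsub>P\<^esub> q \<in> carrier P"
proof -
  have "lin_ext (\<lambda>y. Poly_Mapping.single (x \<star> y) 1) q \<in> carrier P" if "x \<in> Poly_Mapping.keys p" for x
  proof -
    have "Poly_Mapping.keys (Poly_Mapping.single (x \<star> y) (1::complex)) \<subseteq> carrier A \<times> carrier B"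
      if "y \<in> Poly_Mapping.keys q" for y
    proof -
      have "x \<in> carrier A \<times> carrier B" "y \<in> carrier A \<times> carrier B"
        using \<open>x \<in> Poly_Mapping.keys p\<close> that assms by auto
      then show ?thesis by auto
    qed
    then show ?thesis
      using keys_lin_ext[of "\<lambda>y. Poly_Mapping.single (x \<star> y) 1" q] unfolding pair_alg_simps by blast
  qed
  then show ?thesis
    using keys_lin_ext[of "\<lambda>x. lin_ext (\<lambda>y. Poly_Mapping.single (x \<star> y) 1) q" p]
    unfolding pair_mult pair_alg_simps by blast
qed

lemma pair_mult_assoc:
  assumes "p \<in> carrier P" "q \<in> carrier P" "r \<in> carrier P"
  shows "p \<otimes>\<^bsub>P\<^esub> q \<otimes>\<^bsub>P\<^esub> r = p \<otimes>\<^bsub>P\<^esub> (q \<otimes>\<^bsub>P\<^esub> r)"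
  unfolding pair_mult lin_ext_lin_ext lin_ext_single scl_one
proof (intro lin_ext_cong)
  fix x y z
  assume "x \<in> Poly_Mapping.keys p" "y \<in> Poly_Mapping.keys q" "z \<in> Poly_Mapping.keys r"
  with assms have "x \<in> carrier A \<times> carrier B" "y \<in> carrier A \<times> carrier B" "z \<in> carrier A \<times> carrier B"
    by auto
  then show "Poly_Mapping.single ((x \<star> y) \<star> z) (1::complex) = Poly_Mapping.single (x \<star> (y \<star> z)) 1"
    by (auto simp: A.m_assoc B.m_assoc)
qed

lemma pair_mult_one:
  assumes "p \<in> carrier P"
  shows "\<one>\<^bsub>P\<^esub> \<otimes>\<^bsub>P\<^esub> p = p" "p \<otimes>\<^bsub>P\<^esub> \<one>\<^bsub>P\<^esub> = p"
proof -
  have *: "x \<in> carrier A \<times> carrier B" if "x \<in> Poly_Mapping.keys p" for x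
    using assms that by auto
  have "\<one>\<^bsub>P\<^esub> \<otimes>\<^bsub>P\<^esub> p = lin_ext (\<lambda>x. Poly_Mapping.single x 1) p"
    unfolding pair_mult pair_alg_simps lin_ext_single scl_one
    by (rule lin_ext_cong) (use * in auto)
  then show "\<one>\<^bsub>P\<^esub> \<otimes>\<^bsub>P\<^esub> p = p" by simp
  have "p \<otimes>\<^bsub>P\<^esub> \<one>\<^bsub>P\<^esub> = lin_ext (\<lambda>x. Poly_Mapping.single x 1) p"
    unfolding pair_mult pair_alg_simps lin_ext_single scl_one
    by (rule lin_ext_cong) (use * in auto)
  then show "p \<otimes>\<^bsub>P\<^esub> \<one>\<^bsub>P\<^esub> = p" by simp
qed

lemma unital_algebra_pair_alg: "unital_algebra P"
proof (intro unital_algebra.intro unital_algebra_axioms.intro ringI)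
  show "abelian_group P"
  proof (rule abelian_groupI)
    fix x assume "x \<in> carrier P"
    then show "\<exists>y\<in>carrier P. y \<oplus>\<^bsub>P\<^esub> x = \<zero>\<^bsub>P\<^esub>"
      by (intro bexI[of _ "- x"]) auto
  qed (simp_all add: add_ac)
  show "Group.monoid P"
  proof (rule monoidI)
    show "\<one>\<^bsub>P\<^esub> \<in> carrier P" by simp
  qed (fact pair_mult_closed pair_mult_assoc pair_mult_one)+
qed (simp_all add: pair_mult_linear scl_add_left scl_add_right)

sublocale P: unital_algebra P
  by (rule unital_algebra_pair_alg)

lemma pair_minus:
  assumes "p \<in> carrier P" "q \<in> carrier P"
  shows "p \<ominus>\<^bsub>P\<^esub> q = p - q"
proof -
  have "\<ominus>\<^bsub>P\<^esub> q = - q" using P.scale_minus_one[OF assms(2)] by (simp add: uminus_eq_scl)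
  then show ?thesis by (simp add: a_minus_def)
qed

lemma bilinear_relations_closed: "bilinear_relations A B \<subseteq> carrier P"
proof -
  have "Poly_Mapping.single (a, b) c \<in> carrier P" if "a \<in> carrier A" "b \<in> carrier B" for a b c
    using that by simp
  moreover have "p - q \<in> carrier P" if "p \<in> carrier P" "q \<in> carrier P" for p q
    using P.minus_closed[OF that] pair_minus[OF that] by simp
  ultimately show ?thesis
    unfolding bilinear_relations_def by (auto simp del: pair_alg_simps(1))
qed

lemma bilinear_relationsI:
  "a \<in> carrier A \<Longrightarrow> a' \<in> carrier A \<Longrightarrow> b \<in> carrier B \<Longrightarrow>
    Poly_Mapping.single (a \<oplus>\<^bsub>A\<^esub> a', b) 1 - Poly_Mapping.single (a, b) 1
      - Poly_Mapping.single (a', b) 1 \<in> bilinear_relations A B"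
  "a \<in> carrier A \<Longrightarrow> b \<in> carrier B \<Longrightarrow> b' \<in> carrier B \<Longrightarrow>
    Poly_Mapping.single (a, b \<oplus>\<^bsub>B\<^esub> b') 1 - Poly_Mapping.single (a, b) 1
      - Poly_Mapping.single (a, b') 1 \<in> bilinear_relations A B"
  "a \<in> carrier A \<Longrightarrow> b \<in> carrier B \<Longrightarrow>
    Poly_Mapping.single (c \<odot>\<^bsub>A\<^esub> a, b) 1 - Poly_Mapping.single (a, b) c \<in> bilinear_relations A B"
  "a \<in> carrier A \<Longrightarrow> b \<in> carrier B \<Longrightarrow>
    Poly_Mapping.single (a, c \<odot>\<^bsub>B\<^esub> b) 1 - Poly_Mapping.single (a, b) c \<in> bilinear_relations A B"
  unfolding bilinear_relations_def
     apply (rule UnI1, rule UnI1, rule UnI1, rule CollectI, intro exI conjI, rule refl; assumption)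
    apply (rule UnI1, rule UnI1, rule UnI2, rule CollectI, intro exI conjI, rule refl; assumption)
   apply (rule UnI1, rule UnI2, rule CollectI, intro exI conjI, rule refl; assumption)
  apply (rule UnI2, rule CollectI, intro exI conjI, rule refl; assumption)
  done

text \<open>Since the products of \<open>A\<close> and \<open>B\<close> are bilinear, each of the four kinds of relations is sent to
  its own kind.  Hence the relations span an ideal.\<close>

lemma relation_times_single:
  assumes "x \<in> carrier A \<times> carrier B" "r \<in> bilinear_relations A B"
  shows "Poly_Mapping.single x 1 \<otimes>\<^bsub>P\<^esub> r \<in> bilinear_relations A B"
    and "r \<otimes>\<^bsub>P\<^esub> Poly_Mapping.single x 1 \<in> bilinear_relations A B"
  using assms(1) assms(2)[unfolded bilinear_relations_def]
  by (auto simp: pair_mult_linear pair_mult_single A.r_distr A.l_distr B.r_distr B.l_distr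
      A.scale_mult_left A.scale_mult_right B.scale_mult_left B.scale_mult_right
      simp del: pair_alg_simps(1)) (rule bilinear_relationsI; simp)+

lemma carrier_subset_linear_span:
  "carrier P \<subseteq> linear_span P {Poly_Mapping.single x 1 |x. x \<in> carrier A \<times> carrier B}"
    (is "_ \<subseteq> linear_span P ?G")
proof
  fix p assume "p \<in> carrier P"
  have "?G \<subseteq> carrier P" by auto
  note span = P.submodule_linear_span[OF this, unfolded P.submodule_iff]
  from \<open>p \<in> carrier P\<close> have "Poly_Mapping.keys p \<subseteq> carrier A \<times> carrier B" by simp
  then show "p \<in> linear_span P ?G"
  proof (induction p rule: keys_span_induct)
    case (single x)
    then show ?case using P.subset_linear_span[of ?G] by blast
  qed (use span in simp_all)
qed

lemma ideal_tensor_null: "ideal T P"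
  unfolding tensor_null_def
  by (rule P.ideal_linear_span[OF bilinear_relations_closed _ carrier_subset_linear_span])
    (auto simp: relation_times_single)

lemma unital_algebra_tensor_alg: "unital_algebra AB"
  unfolding tensor_alg_def by (rule P.unital_algebra_quotient_alg[OF ideal_tensor_null])

sublocale AB: unital_algebra AB
  by (rule unital_algebra_tensor_alg)

lemma tensor_coset_hom: "unital_algebra_hom P AB (\<lambda>p. T +>\<^bsub>P\<^esub> p)"
  unfolding tensor_alg_def by (rule P.coset_hom[OF ideal_tensor_null])

sublocale coset: unital_algebra_hom P AB "\<lambda>p. T +>\<^bsub>P\<^esub> p"
  by (rule tensor_coset_hom)

lemma pure_tensor_closed [simp]:
  "a \<in> carrier A \<Longrightarrow> b \<in> carrier B \<Longrightarrow> pure_tensor A B a b \<in> carrier AB"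
  unfolding pure_tensor_def by (rule coset.hom_closed) simp

lemma pure_tensor_one: "pure_tensor A B \<one>\<^bsub>A\<^esub> \<one>\<^bsub>B\<^esub> = \<one>\<^bsub>AB\<^esub>"
  unfolding pure_tensor_def using coset.hom_one by simp

lemma pure_tensor_mult:
  assumes "a \<in> carrier A" "b \<in> carrier B" "a' \<in> carrier A" "b' \<in> carrier B"
  shows "pure_tensor A B a b \<otimes>\<^bsub>AB\<^esub> pure_tensor A B a' b' =
    pure_tensor A B (a \<otimes>\<^bsub>A\<^esub> a') (b \<otimes>\<^bsub>B\<^esub> b')"
  unfolding pure_tensor_def using assms
  by (subst coset.hom_mult[symmetric]) (simp_all add: pair_mult_single)

lemma coset_eq_of_relation:
  assumes "p \<in> carrier P" "q \<in> carrier P" "p - q \<in> bilinear_relations A B"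
  shows "T +>\<^bsub>P\<^esub> p = T +>\<^bsub>P\<^esub> q"
proof -
  have "p - q \<in> T"
    using assms(3) P.subset_linear_span[of "bilinear_relations A B"] by (auto simp: tensor_null_def)
  then show ?thesis
    using P.coset_eq_iff[OF ideal_tensor_null assms(1,2)] pair_minus[OF assms(1,2)] by simp
qed

lemma pure_tensor_scale_left:
  assumes "a \<in> carrier A" "b \<in> carrier B"
  shows "pure_tensor A B (c \<odot>\<^bsub>A\<^esub> a) b = c \<odot>\<^bsub>AB\<^esub> pure_tensor A B a b"
proof -
  have "pure_tensor A B (c \<odot>\<^bsub>A\<^esub> a) b = T +>\<^bsub>P\<^esub> Poly_Mapping.single (a, b) c"
    unfolding pure_tensor_def
    by (rule coset_eq_of_relation) (use assms in \<open>auto intro: bilinear_relationsI\<close>)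
  also have "\<dots> = T +>\<^bsub>P\<^esub> (c \<odot>\<^bsub>P\<^esub> Poly_Mapping.single (a, b) 1)" by simp
  also have "\<dots> = c \<odot>\<^bsub>AB\<^esub> pure_tensor A B a b"
    unfolding pure_tensor_def using assms by (subst coset.hom_scale) simp_all
  finally show ?thesis .
qed

lemma pure_tensor_scale_right:
  assumes "a \<in> carrier A" "b \<in> carrier B"
  shows "pure_tensor A B a (c \<odot>\<^bsub>B\<^esub> b) = c \<odot>\<^bsub>AB\<^esub> pure_tensor A B a b"
proof -
  have "pure_tensor A B a (c \<odot>\<^bsub>B\<^esub> b) = T +>\<^bsub>P\<^esub> Poly_Mapping.single (a, b) c"
    unfolding pure_tensor_def
    by (rule coset_eq_of_relation) (use assms in \<open>auto intro: bilinear_relationsI\<close>)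
  also have "\<dots> = T +>\<^bsub>P\<^esub> (c \<odot>\<^bsub>P\<^esub> Poly_Mapping.single (a, b) 1)" by simp
  also have "\<dots> = c \<odot>\<^bsub>AB\<^esub> pure_tensor A B a b"
    unfolding pure_tensor_def using assms by (subst coset.hom_scale) simp_all
  finally show ?thesis .
qed

lemma pure_tensor_add_left:
  assumes "a \<in> carrier A" "a' \<in> carrier A" "b \<in> carrier B"
  shows "pure_tensor A B (a \<oplus>\<^bsub>A\<^esub> a') b = pure_tensor A B a b \<oplus>\<^bsub>AB\<^esub> pure_tensor A B a' b"
proof -
  have "pure_tensor A B (a \<oplus>\<^bsub>A\<^esub> a') b =
      T +>\<^bsub>P\<^esub> (Poly_Mapping.single (a, b) 1 \<oplus>\<^bsub>P\<^esub> Poly_Mapping.single (a', b) 1)"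
    unfolding pure_tensor_def
  proof (rule coset_eq_of_relation)
    show "Poly_Mapping.single (a, b) 1 \<oplus>\<^bsub>P\<^esub> Poly_Mapping.single (a', b) 1 \<in> carrier P"
      using assms by (intro P.a_closed) auto
  qed (use assms in \<open>auto intro: bilinear_relationsI simp: diff_diff_eq[symmetric]\<close>)
  also have "\<dots> = pure_tensor A B a b \<oplus>\<^bsub>AB\<^esub> pure_tensor A B a' b"
    unfolding pure_tensor_def using assms by (subst coset.hom_add) simp_all
  finally show ?thesis .
qed

lemma pure_tensor_add_right:
  assumes "a \<in> carrier A" "b \<in> carrier B" "b' \<in> carrier B"
  shows "pure_tensor A B a (b \<oplus>\<^bsub>B\<^esub> b') = pure_tensor A B a b \<oplus>\<^bsub>AB\<^esub> pure_tensor A B a b'"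
proof -
  have "pure_tensor A B a (b \<oplus>\<^bsub>B\<^esub> b') =
      T +>\<^bsub>P\<^esub> (Poly_Mapping.single (a, b) 1 \<oplus>\<^bsub>P\<^esub> Poly_Mapping.single (a, b') 1)"
    unfolding pure_tensor_def
  proof (rule coset_eq_of_relation)
    show "Poly_Mapping.single (a, b) 1 \<oplus>\<^bsub>P\<^esub> Poly_Mapping.single (a, b') 1 \<in> carrier P"
      using assms by (intro P.a_closed) auto
  qed (use assms in \<open>auto intro: bilinear_relationsI simp: diff_diff_eq[symmetric]\<close>)
  also have "\<dots> = pure_tensor A B a b \<oplus>\<^bsub>AB\<^esub> pure_tensor A B a b'"
    unfolding pure_tensor_def using assms by (subst coset.hom_add) simp_all
  finally show ?thesis .
qed

text \<open>The embeddings of the two factors into the tensor product.\<close>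

lemma pure_left_hom: "unital_algebra_hom A AB (\<lambda>a. pure_tensor A B a \<one>\<^bsub>B\<^esub>)"
  by standard (simp_all add: pure_tensor_add_left pure_tensor_mult pure_tensor_one pure_tensor_scale_left)

lemma pure_right_hom: "unital_algebra_hom B AB (\<lambda>b. pure_tensor A B \<one>\<^bsub>A\<^esub> b)"
  by standard (simp_all add: pure_tensor_add_right pure_tensor_mult pure_tensor_one pure_tensor_scale_right)

text \<open>Pure tensors of elements of \<open>U\<close> and \<open>V\<close> are closed under products, hence so is their span.\<close>

lemma subalg_tensor_subspace:
  assumes U: "subalg U A" and V: "subalg V B"
  shows "subalg (tensor_subspace A B U V) AB"
proof -
  have U': "U \<subseteq> carrier A" and V': "V \<subseteq> carrier B"
    using U V by (simp_all add: A.subalg_iff A.submodule_iff B.subalg_iff B.submodule_iff)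
  show ?thesis
    unfolding tensor_subspace_def
  proof (rule AB.subalg_linear_span)
    show "{pure_tensor A B a b |a b. a \<in> U \<and> b \<in> V} \<subseteq> carrier AB"
      using U' V' pure_tensor_closed by blast
    show "\<one>\<^bsub>AB\<^esub> \<in> {pure_tensor A B a b |a b. a \<in> U \<and> b \<in> V}"
      using U V pure_tensor_one[symmetric] unfolding A.subalg_iff B.subalg_iff by blast
    fix x y assume "x \<in> {pure_tensor A B a b |a b. a \<in> U \<and> b \<in> V}"
      "y \<in> {pure_tensor A B a b |a b. a \<in> U \<and> b \<in> V}"
    then obtain a b a' b' where "x = pure_tensor A B a b" "y = pure_tensor A B a' b'"
      "a \<in> U" "b \<in> V" "a' \<in> U" "b' \<in> V" by blast
    moreover from this have "x \<otimes>\<^bsub>AB\<^esub> y = pure_tensor A B (a \<otimes>\<^bsub>A\<^esub> a') (b \<otimes>\<^bsub>B\<^esub> b')"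
      using U' V' by (simp add: pure_tensor_mult subset_iff)
    ultimately show "x \<otimes>\<^bsub>AB\<^esub> y \<in> {pure_tensor A B a b |a b. a \<in> U \<and> b \<in> V}"
      using U V unfolding A.subalg_iff B.subalg_iff by blast
  qed
qed

lemma pure_tensor_in_tensor_subspace:
  "a \<in> U \<Longrightarrow> b \<in> V \<Longrightarrow> pure_tensor A B a b \<in> tensor_subspace A B U V"
  unfolding tensor_subspace_def by (rule AB.subset_linear_span[THEN subsetD]) blast

end

unbundle fps_syntax
notation fls_nth (infixl \<open>$$\<close> 75)

section \<open>Ring homomorphisms and Laurent series\<close>

locale ring_morphism =
  fixes h :: "'a::ring_1 \<Rightarrow> 'b::ring_1"
  assumes add: "h (x + y) = h x + h y"
    and mult: "h (x * y) = h x * h y"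
    and one: "h 1 = 1"
begin

lemma zero: "h 0 = 0"
  using add[of 0 0] by simp

lemma diff: "h (x - y) = h x - h y"
  using add[of "x - y" y] by (simp add: algebra_simps)

lemma sum: "h (\<Sum>i\<in>I. f i) = (\<Sum>i\<in>I. h (f i))"
  by (induction I rule: infinite_finite_induct) (simp_all add: zero add)

end

lemma fls_nth_fls_map: "h 0 = 0 \<Longrightarrow> fls_map h f $$ n = h (f $$ n)"
  unfolding fls_map_def
  by (rule nth_Abs_fls, rule MOST_mono[OF MOST_fls_neg_nth_eq_0[of f]]) simp

text \<open>The order of a series can grow when a homomorphism is applied to its coefficients; a product
  formula that sums from arbitrary lower bounds of the orders is stable under this.\<close>

lemma fls_times_nth_bounds:
  assumes f: "\<And>i. i < a \<Longrightarrow> f $$ i = 0" and g: "\<And>i. i < b \<Longrightarrow> g $$ i = 0"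
  shows "(f * g) $$ n = (\<Sum>i=a..n - b. f $$ i * (g $$ (n - i) :: 'a::semiring_0))"
proof -
  let ?U = "{min a (fls_subdegree f)..n - min b (fls_subdegree g)}"
  have "(f * g) $$ n = (\<Sum>i\<in>?U. f $$ i * g $$ (n - i))"
    unfolding fls_times_nth(2) by (rule sum.mono_neutral_left) (auto simp: not_le)
  also have "\<dots> = (\<Sum>i=a..n - b. f $$ i * g $$ (n - i))"
    by (rule sum.mono_neutral_right) (auto simp: not_le f g)
  finally show ?thesis .
qed

context ring_morphism
begin

lemma fls_map_nth [simp]: "fls_map h f $$ n = h (f $$ n)"
  by (rule fls_nth_fls_map[of h, OF zero])

lemma fls_map_morphism: "ring_morphism (fls_map h)"
proof
  fix f g :: "'a fls"
  show "fls_map h (f + g) = fls_map h f + fls_map h g"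
    by (rule fls_eqI) (simp add: add)
  show "fls_map h (f * g) = fls_map h f * fls_map h g"
  proof (rule fls_eqI)
    fix n
    show "fls_map h (f * g) $$ n = (fls_map h f * fls_map h g) $$ n"
      by (simp add: fls_times_nth_bounds[of "fls_subdegree f" _ "fls_subdegree g"] sum mult zero)
  qed
  show "fls_map h 1 = 1"
    by (rule fls_eqI) (simp add: one zero)
qed

lemma fls_map_const: "fls_map h (fls_const c) = fls_const (h c)"
  by (rule fls_eqI) (simp add: zero)

lemma fls_map_fps_to_fls: "fls_map h (fps_to_fls f) = fps_to_fls (Abs_fps (\<lambda>n. h (f $ n)))"
  by (rule fls_eqI) (simp add: zero)

end

definition add_closed :: "'a::comm_monoid_add set \<Rightarrow> bool" where
  "add_closed S \<longleftrightarrow> 0 \<in> S \<and> (\<forall>x\<in>S. \<forall>y\<in>S. x + y \<in> S)"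

lemma add_closed_sum: "add_closed S \<Longrightarrow> (\<And>i. i \<in> I \<Longrightarrow> f i \<in> S) \<Longrightarrow> sum f I \<in> S"
  by (induction I rule: infinite_finite_induct) (auto simp: add_closed_def)

definition fls_over :: "'a::zero set \<Rightarrow> 'a fls set" where
  "fls_over S = {f. \<forall>n. f $$ n \<in> S}"

lemma add_closed_fls_over: "add_closed S \<Longrightarrow> add_closed (fls_over S)"
  by (simp add: add_closed_def fls_over_def)

lemma fls_over_times:
  assumes "add_closed S" "\<And>x y. x \<in> S1 \<Longrightarrow> y \<in> S2 \<Longrightarrow> x * y \<in> S"
    and "f \<in> fls_over S1" "g \<in> fls_over S2"
  shows "f * g \<in> fls_over (S :: 'a::semiring_0 set)"
  using assms by (auto simp: fls_over_def fls_times_nth(2) intro!: add_closed_sum)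

lemma tensor_matrix_mult_assoc:
  "tensor_matrix_mult N (tensor_matrix_mult N A B) C = tensor_matrix_mult N A (tensor_matrix_mult N B C)"
proof (intro ext)
  fix i j k l
  let ?I = "index_set N"
  have "tensor_matrix_mult N (tensor_matrix_mult N A B) C i j k l =
      (\<Sum>x\<in>?I \<times> ?I. \<Sum>y\<in>?I \<times> ?I. A i (fst y) k (snd y) * B (fst y) (fst x) (snd y) (snd x) * C (fst x) j (snd x) l)"
    by (simp add: tensor_matrix_mult_def sum.cartesian_product' sum_distrib_right)
  also have "\<dots> = (\<Sum>y\<in>?I \<times> ?I. \<Sum>x\<in>?I \<times> ?I. A i (fst y) k (snd y) * B (fst y) (fst x) (snd y) (snd x) * C (fst x) j (snd x) l)"
    by (rule sum.swap)
  also have "\<dots> = tensor_matrix_mult N A (tensor_matrix_mult N B C) i j k l"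
    by (simp add: tensor_matrix_mult_def sum.cartesian_product' sum_distrib_left mult.assoc)
  finally show "tensor_matrix_mult N (tensor_matrix_mult N A B) C i j k l =
    tensor_matrix_mult N A (tensor_matrix_mult N B C) i j k l" .
qed

lemma (in ring_morphism) tensor_matrix_mult:
  "h (tensor_matrix_mult N A B i j k l) =
    tensor_matrix_mult N (\<lambda>i j k l. h (A i j k l)) (\<lambda>i j k l. h (B i j k l)) i j k l"
  by (simp add: tensor_matrix_mult_def sum mult)

lemma tensor_matrix_mult_over:
  assumes "add_closed S" "\<And>x y. x \<in> S1 \<Longrightarrow> y \<in> S2 \<Longrightarrow> x * y \<in> S"
    and "\<And>a b. a \<in> index_set N \<Longrightarrow> b \<in> index_set N \<Longrightarrow> A i a k b \<in> S1"
    and "\<And>a b. a \<in> index_set N \<Longrightarrow> b \<in> index_set N \<Longrightarrow> B a j b l \<in> S2"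
  shows "tensor_matrix_mult N A B i j k l \<in> S"
  unfolding tensor_matrix_mult_def using assms by (intro add_closed_sum) auto

section \<open>Homomorphisms of monoid algebras\<close>

lemma lin_ext_morphism:
  fixes f :: "'m::monoid_add \<Rightarrow> ('k::monoid_add \<Rightarrow>\<^sub>0 complex)"
  assumes "f 0 = 1" "\<And>x y. f (x + y) = f x * f y"
  shows "ring_morphism (lin_ext f)"
  by standard (simp_all add: assms lin_ext_add lin_ext_times lin_ext_single[of f 0 1, simplified])

lemma scl_of_one: "scl c 1 = Poly_Mapping.single 0 c"
  by (rule poly_mapping_eqI) (simp add: lookup_one lookup_single when_def)

lemma lin_ext_scalar:
  "f 0 = 1 \<Longrightarrow> lin_ext f (Poly_Mapping.single 0 c) = Poly_Mapping.single 0 c"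
  by (simp add: scl_of_one)

lemma finsum_monoid_alg:
  assumes "unital_algebra (monoid_alg S)" "f \<in> I \<rightarrow> carrier (monoid_alg S)"
  shows "finsum (monoid_alg S) f I = sum f I"
  using assms(2)
proof (induction I rule: infinite_finite_induct)
  case (insert i I)
  interpret unital_algebra "monoid_alg S" by (rule assms(1))
  from insert have "f \<in> I \<rightarrow> carrier (monoid_alg S)" "f i \<in> carrier (monoid_alg S)" by auto
  with insert show ?case by (simp add: finsum_insert)
next
  case (infinite I)
  interpret unital_algebra "monoid_alg S" by (rule assms(1))
  show ?case using infinite by simp
next
  case empty
  interpret unital_algebra "monoid_alg S" by (rule assms(1))
  show ?case by simp
qed

text \<open>Uniqueness in the universal property of a monoid algebra.\<close>

lemma hom_eq_on_basis:
  assumes "unital_algebra_hom (monoid_alg S) B h" "unital_algebra_hom (monoid_alg S) B h'"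
    and basis: "\<And>x. x \<in> S \<Longrightarrow> h (Poly_Mapping.single x 1) = h' (Poly_Mapping.single x 1)"
    and p: "p \<in> carrier (monoid_alg S)"
  shows "h p = h' p"
proof -
  interpret h: unital_algebra_hom "monoid_alg S" B h by fact
  interpret h': unital_algebra_hom "monoid_alg S" B h' by fact
  from p have "Poly_Mapping.keys p \<subseteq> S" by simp
  then show ?thesis
  proof (induction p rule: keys_span_induct)
    case zero
    show ?case using h.hom_zero h'.hom_zero by simp
  next
    case (single x)
    then show ?case by (rule basis)
  next
    case (scale c p)
    then show ?case using h.hom_scale[of p c] h'.hom_scale[of p c] by simp
  next
    case (add p q)
    then show ?case using h.hom_add[of p q] h'.hom_add[of p q] by simp
  qed
qed

lemma (in tensor_product) lin_ext_pair_hom: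
  assumes S: "0 \<in> S" "\<And>x y. x \<in> S \<Longrightarrow> y \<in> S \<Longrightarrow> x + y \<in> S"
    and g: "\<And>x. x \<in> S \<Longrightarrow> g x \<in> carrier A \<times> carrier B"
    and g0: "g 0 = (\<one>\<^bsub>A\<^esub>, \<one>\<^bsub>B\<^esub>)"
    and g_add: "\<And>x y. x \<in> S \<Longrightarrow> y \<in> S \<Longrightarrow> g (x + y) = (fst (g x) \<otimes>\<^bsub>A\<^esub> fst (g y), snd (g x) \<otimes>\<^bsub>B\<^esub> snd (g y))"
  shows "unital_algebra_hom (monoid_alg S) P (lin_ext (\<lambda>x. Poly_Mapping.single (g x) 1))"
proof (intro unital_algebra_hom.intro unital_algebra_hom_axioms.intro)
  let ?h = "lin_ext (\<lambda>x. Poly_Mapping.single (g x) 1)"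
  show "unital_algebra (monoid_alg S)" using S by (rule unital_algebra_monoid_alg)
  show "unital_algebra P" by (rule unital_algebra_pair_alg)
  show "?h \<one>\<^bsub>monoid_alg S\<^esub> = \<one>\<^bsub>P\<^esub>"
    using lin_ext_single[of "\<lambda>x. Poly_Mapping.single (g x) 1" 0 1] by (simp add: g0)
  fix p q assume pq: "p \<in> carrier (monoid_alg S)" "q \<in> carrier (monoid_alg S)"
  show "?h (p \<otimes>\<^bsub>monoid_alg S\<^esub> q) = ?h p \<otimes>\<^bsub>P\<^esub> ?h q"
    unfolding monoid_alg_simps pair_mult times_eq_lin_ext lin_ext_lin_ext lin_ext_single scl_one
    by (intro lin_ext_cong) (use pq g_add in \<open>auto simp: subset_iff\<close>)
next
  fix p assume p: "p \<in> carrier (monoid_alg S)"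
  show "lin_ext (\<lambda>x. Poly_Mapping.single (g x) 1) p \<in> carrier P"
    unfolding pair_alg_simps
  proof (rule order.trans[OF keys_lin_ext], rule UN_least)
    fix x assume "x \<in> Poly_Mapping.keys p"
    with p g[of x] show "Poly_Mapping.keys (Poly_Mapping.single (g x) (1::complex)) \<subseteq> carrier A \<times> carrier B"
      by auto
  qed
qed (simp_all add: lin_ext_add lin_ext_scl)

section \<open>Free algebras\<close>

definition words :: "'g set \<Rightarrow> 'g word set" where
  "words G = {w. set (letters w) \<subseteq> G}"

lemma words_zero [simp]: "0 \<in> words G"
  and words_add [simp]: "v \<in> words G \<Longrightarrow> w \<in> words G \<Longrightarrow> v + w \<in> words G"
  by (simp_all add: words_def zero_word_def plus_word_def)

lemma letters_zero [simp]: "letters 0 = []"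
  and letters_add [simp]: "letters (v + w) = letters v @ letters w"
  by (simp_all add: zero_word_def plus_word_def)

lemma scalar_times: "scalar c * p = scl c p"
  by (simp add: scalar_def single_zero_times)

lemma free_alg_eq: "free_alg G = monoid_alg (words G)"
  by (auto simp: free_alg_def monoid_alg_def words_def scalar_times)

lemma unital_algebra_free_alg: "unital_algebra (free_alg G)"
  unfolding free_alg_eq by (rule unital_algebra_monoid_alg) simp_all

lemma letter_closed: "g \<in> G \<Longrightarrow> letter g \<in> carrier (free_alg G)"
  by (simp add: free_alg_eq letter_def words_def)

definition free_hom :: "('g \<Rightarrow> ('m::monoid_add \<Rightarrow>\<^sub>0 complex)) \<Rightarrow> 'g free \<Rightarrow> ('m \<Rightarrow>\<^sub>0 complex)" where
  "free_hom d = lin_ext (\<lambda>w. prod_list (map d (letters w)))"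

lemma free_hom_morphism: "ring_morphism (free_hom d)"
  unfolding free_hom_def by (rule lin_ext_morphism) simp_all

lemma free_hom_letter: "free_hom d (letter g) = d g"
  by (simp add: free_hom_def letter_def)

lemma free_hom_scalar: "free_hom d (scalar c) = Poly_Mapping.single 0 c"
  unfolding free_hom_def scalar_def by (rule lin_ext_scalar) simp

lemma free_hom_closed:
  assumes "0 \<in> S" "\<And>x y. x \<in> S \<Longrightarrow> y \<in> S \<Longrightarrow> x + y \<in> S"
    and "\<And>g. g \<in> G \<Longrightarrow> d g \<in> carrier (monoid_alg S)"
  shows "unital_algebra_hom (free_alg G) (monoid_alg S) (free_hom d)"
proof -
  interpret M: unital_algebra "monoid_alg S" using assms(1,2) by (rule unital_algebra_monoid_alg)
  interpret F: unital_algebra "free_alg G" by (rule unital_algebra_free_alg)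
  interpret h: ring_morphism "free_hom d" by (rule free_hom_morphism)
  have word: "prod_list (map d gs) \<in> carrier (monoid_alg S)" if "set gs \<subseteq> G" for gs
    using that
  proof (induction gs)
    case Nil
    then show ?case using M.one_closed by simp
  next
    case (Cons g gs)
    then show ?case using M.m_closed[of "d g" "prod_list (map d gs)"] assms(3) by simp
  qed
  show ?thesis
  proof
    fix p assume "p \<in> carrier (free_alg G)"
    then show "free_hom d p \<in> carrier (monoid_alg S)"
      unfolding free_alg_eq free_hom_def monoid_alg_simps
      using word by (intro order.trans[OF keys_lin_ext]) (fastforce simp: words_def)
  qed (simp_all add: free_alg_eq h.add h.mult h.one, simp add: free_hom_def lin_ext_scl)
qed

text \<open>A homomorphism \<open>h\<close> out of a monoid algebra turns lifts into lifts.  This identifies \<open>free_lift\<close>,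
  whose values lie in the carrier of a record, with a map that factors through a ring that is a type.\<close>

lemma free_lift_eq_hom:
  assumes h: "unital_algebra_hom (monoid_alg S) B h"
    and S: "0 \<in> S" "\<And>x y. x \<in> S \<Longrightarrow> y \<in> S \<Longrightarrow> x + y \<in> S"
    and d: "\<And>g. g \<in> G \<Longrightarrow> d g \<in> carrier (monoid_alg S)"
    and f: "\<And>g. g \<in> G \<Longrightarrow> f g = h (d g)"
    and p: "p \<in> carrier (free_alg G)"
  shows "free_lift B f p = h (free_hom d p)"
proof -
  interpret h: unital_algebra_hom "monoid_alg S" B h by (rule h)
  interpret d: unital_algebra_hom "free_alg G" "monoid_alg S" "free_hom d"
    using S d by (rule free_hom_closed)
  have word: "prod_list (map d gs) \<in> carrier (monoid_alg S) \<and>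
      foldr (\<lambda>g z. f g \<otimes>\<^bsub>B\<^esub> z) gs \<one>\<^bsub>B\<^esub> = h (prod_list (map d gs))" if "set gs \<subseteq> G" for gs
    using that
  proof (induction gs)
    case Nil
    then show ?case using h.A.one_closed h.hom_one by simp
  next
    case (Cons g gs)
    then show ?case
      using h.A.m_closed[of "d g" "prod_list (map d gs)"] d[of g] f[of g]
        h.hom_mult[of "d g" "prod_list (map d gs)"] by simp
  qed
  \<comment> \<open>Both sides are sums over the words of \<open>p\<close> of \<open>h (?t w)\<close>.\<close>
  let ?t = "\<lambda>w. scl (Poly_Mapping.lookup p w) (prod_list (map d (letters w)))"
  have closed: "prod_list (map d (letters w)) \<in> carrier (monoid_alg S)"
    and eq: "foldr (\<lambda>g z. f g \<otimes>\<^bsub>B\<^esub> z) (letters w) \<one>\<^bsub>B\<^esub> = h (prod_list (map d (letters w)))"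
    if "w \<in> Poly_Mapping.keys p" for w
    using word[of "letters w"] p that by (auto simp: free_alg_eq words_def)
  have t: "?t \<in> Poly_Mapping.keys p \<rightarrow> carrier (monoid_alg S)"
    using closed by auto
  have "free_lift B f p = (\<Oplus>\<^bsub>B\<^esub>w\<in>Poly_Mapping.keys p. h (?t w))"
    unfolding free_lift_def
  proof (rule h.B.finsum_cong')
    show "(\<lambda>w. h (?t w)) \<in> Poly_Mapping.keys p \<rightarrow> carrier B"
      using t h.hom_closed by blast
    fix w assume w: "w \<in> Poly_Mapping.keys p"
    show "Poly_Mapping.lookup p w \<odot>\<^bsub>B\<^esub> foldr (\<lambda>g z. f g \<otimes>\<^bsub>B\<^esub> z) (letters w) \<one>\<^bsub>B\<^esub> = h (?t w)"
      using h.hom_scale[OF closed[OF w]] eq[OF w] by simp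
  qed simp
  also have "\<dots> = h (finsum (monoid_alg S) ?t (Poly_Mapping.keys p))"
    using t by (rule h.hom_finsum[symmetric])
  also have "finsum (monoid_alg S) ?t (Poly_Mapping.keys p) = free_hom d p"
    unfolding free_hom_def lin_ext_def
    by (rule finsum_monoid_alg[OF unital_algebra_monoid_alg t]) (use S in auto)
  finally show ?thesis .
qed

lemma finite_index_set [simp]: "finite (index_set N)"
  by (simp add: index_set_def)

section \<open>The tensor square of a free algebra\<close>

text \<open>The pairs of words form a monoid, and the product of its monoid algebra is
  \<open>(p \<otimes> q) (p' \<otimes> q') = p p' \<otimes> q q'\<close>: so this ring is the tensor square of the free algebra.\<close>

type_synonym 'g free2 = "('g word \<times> 'g word) \<Rightarrow>\<^sub>0 complex"

definition inl_free :: "'g free \<Rightarrow> 'g free2" where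
  "inl_free = lin_ext (\<lambda>w. Poly_Mapping.single (w, 0) 1)"

definition inr_free :: "'g free \<Rightarrow> 'g free2" where
  "inr_free = lin_ext (\<lambda>w. Poly_Mapping.single (0, w) 1)"

lemma single_pair_zero [simp]: "Poly_Mapping.single (0, 0) (1::complex) = 1"
  unfolding zero_prod_def[symmetric] by (rule single_one)

interpretation inl_ring: ring_morphism inl_free
  unfolding inl_free_def by (rule lin_ext_morphism) (simp_all add: mult_single)

interpretation inr_ring: ring_morphism inr_free
  unfolding inr_free_def by (rule lin_ext_morphism) (simp_all add: mult_single)

lemma inl_free_scalar: "inl_free (scalar c) = Poly_Mapping.single 0 c"
  unfolding inl_free_def scalar_def by (rule lin_ext_scalar) simp

lemma inr_free_scalar: "inr_free (scalar c) = Poly_Mapping.single 0 c"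
  unfolding inr_free_def scalar_def by (rule lin_ext_scalar) simp

lemma lin_ext_swap:
  "lin_ext (\<lambda>x. lin_ext (\<lambda>y. f x y) q) p = lin_ext (\<lambda>y. lin_ext (\<lambda>x. f x y) p) q"
  unfolding lin_ext_def scl_sum
  by (subst sum.swap) (simp add: mult.commute)

lemma inl_times_inr:
  "inl_free p * inr_free q = lin_ext (\<lambda>v. lin_ext (\<lambda>w. Poly_Mapping.single (v, w) 1) q) p"
  by (simp add: times_eq_lin_ext inl_free_def inr_free_def lin_ext_lin_ext)

text \<open>The commutation of the two tensor factors, on which the reordering of matrix products rests.\<close>

lemma inr_times_inl: "inr_free q * inl_free p = inl_free p * inr_free q"
  unfolding inl_times_inr
  by (subst lin_ext_swap) (simp add: times_eq_lin_ext inl_free_def inr_free_def lin_ext_lin_ext)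

lemma fls_times_commute:
  fixes f g :: "'a::semiring_0 fls"
  assumes "\<And>i j. f $$ i * g $$ j = g $$ j * f $$ i"
  shows "f * g = g * f"
proof (rule fls_eqI)
  fix n
  have "(f * g) $$ n = (\<Sum>i=fls_subdegree f..n - fls_subdegree g. g $$ (n - i) * f $$ i)"
    by (simp add: fls_times_nth(2) assms)
  also have "\<dots> = (\<Sum>i=fls_subdegree g..n - fls_subdegree f. g $$ i * f $$ (n - i))"
    by (rule sum.reindex_bij_witness[of _ "\<lambda>i. n - i" "\<lambda>i. n - i"]) auto
  also have "\<dots> = (g * f) $$ n" by (simp add: fls_times_nth(2))
  finally show "(f * g) $$ n = (g * f) $$ n" .
qed

interpretation fls_const: ring_morphism fls_const
  by standard (simp_all add: fls_plus_const)

text \<open>The sum over \<open>s\<close> in the coproduct of a generator is the convolution that multiplies power series.\<close>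

lemma fps_to_fls_convolution:
  fixes a b :: "int \<Rightarrow> nat \<Rightarrow> 'a::ring_1"
  shows "fps_to_fls (Abs_fps (\<lambda>r. \<Sum>k\<in>I. \<Sum>s\<le>r. a k s * b k (r - s))) =
    (\<Sum>k\<in>I. fps_to_fls (Abs_fps (a k)) * fps_to_fls (Abs_fps (b k)))"
  by (rule fls_eqI)
    (simp add: fls_nth_sum fls_times_fps_to_fls[symmetric] fps_mult_nth atMost_atLeast0)

text \<open>The formula for the coproduct of a generator before passing to the quotient.\<close>

definition comult_letter :: "nat \<Rightarrow> gen \<Rightarrow> gen free2" where
  "comult_letter N = (\<lambda>(i, j, r).
     \<Sum>k\<in>index_set N. \<Sum>s\<le>r. inl_free (letter (i, k, s)) * inr_free (letter (k, j, r - s)))"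

definition comult :: "nat \<Rightarrow> gen free \<Rightarrow> gen free2" where
  "comult N = free_hom (comult_letter N)"

interpretation comult_ring: ring_morphism "comult N"
  unfolding comult_def by (rule free_hom_morphism)

lemma comult_scalar: "comult N (scalar c) = Poly_Mapping.single 0 c"
  by (simp add: comult_def free_hom_scalar)

lemma comult_letter: "comult N (letter (i, j, r)) =
    (\<Sum>k\<in>index_set N. \<Sum>s\<le>r. inl_free (letter (i, k, s)) * inr_free (letter (k, j, r - s)))"
  by (simp add: comult_def free_hom_letter comult_letter_def)

section \<open>The RTT relation\<close>

interpretation fls_inl: ring_morphism "fls_map inl_free" by (rule inl_ring.fls_map_morphism)
interpretation fls_inr: ring_morphism "fls_map inr_free" by (rule inr_ring.fls_map_morphism)
interpretation fls_comult: ring_morphism "fls_map (comult N)" by (rule comult_ring.fls_map_morphism)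
interpretation fls2_inl: ring_morphism "fls_map (fls_map inl_free)" by (rule fls_inl.fls_map_morphism)
interpretation fls2_inr: ring_morphism "fls_map (fls_map inr_free)" by (rule fls_inr.fls_map_morphism)
interpretation fls2_comult: ring_morphism "fls_map (fls_map (comult N))"
  by (rule fls_comult.fls_map_morphism)

text \<open>Entries of products are meaningful only at indices of the matrix algebra, since sums run over
  those indices; identities between matrices are asserted there.\<close>

definition eq_on_indices :: "nat \<Rightarrow> 'a tensor_matrix \<Rightarrow> 'a tensor_matrix \<Rightarrow> bool" where
  "eq_on_indices N A B \<longleftrightarrow> (\<forall>i\<in>index_set N. \<forall>j\<in>index_set N. \<forall>k\<in>index_set N. \<forall>l\<in>index_set N. A i j k l = B i j k l)"

lemma eq_on_indices_refl [simp]: "eq_on_indices N A A" by (simp add: eq_on_indices_def)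
lemma eq_on_indices_sym: "eq_on_indices N A B \<Longrightarrow> eq_on_indices N B A" by (simp add: eq_on_indices_def)
lemma eq_on_indices_trans [trans]: "eq_on_indices N A B \<Longrightarrow> eq_on_indices N B C \<Longrightarrow> eq_on_indices N A C" by (simp add: eq_on_indices_def)

lemma eq_on_indices_mult:
  "eq_on_indices N A A' \<Longrightarrow> eq_on_indices N B B' \<Longrightarrow> eq_on_indices N (tensor_matrix_mult N A B) (tensor_matrix_mult N A' B')"
  by (simp add: eq_on_indices_def tensor_matrix_mult_def)

definition R_scalar :: "family \<Rightarrow> nat \<Rightarrow> 'g free2 fls fls tensor_matrix" where
  "R_scalar F N i j k l = fls_map (fls_map (Poly_Mapping.single 0)) (R_matrix F N i j k l)"

text \<open>A matrix \<open>A\<close> over a ring, acting as \<open>A \<otimes> I\<close> or as \<open>I \<otimes> A\<close> in the square of the matrix algebra.\<close>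

definition first_factor :: "(int \<Rightarrow> int \<Rightarrow> 'a::zero) \<Rightarrow> 'a tensor_matrix" where
  "first_factor A i j k l = (if k = l then A i j else 0)"

definition second_factor :: "(int \<Rightarrow> int \<Rightarrow> 'a::zero) \<Rightarrow> 'a tensor_matrix" where
  "second_factor A i j k l = (if i = j then A k l else 0)"

definition index_matrix_mult :: "nat \<Rightarrow> (int \<Rightarrow> int \<Rightarrow> 'a::semiring_0) \<Rightarrow> (int \<Rightarrow> int \<Rightarrow> 'a) \<Rightarrow> int \<Rightarrow> int \<Rightarrow> 'a" where
  "index_matrix_mult N A B i j = (\<Sum>a\<in>index_set N. A i a * B a j)"

lemma sum_delta_times:
  fixes x c :: "'i \<Rightarrow> 'a::semiring_0"
  shows "finite I \<Longrightarrow> k \<in> I \<Longrightarrow> (\<Sum>b\<in>I. (if k = b then x b else 0) * c b) = x k * c k"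
    and "finite I \<Longrightarrow> k \<in> I \<Longrightarrow> (\<Sum>b\<in>I. x b * (if b = k then c b else 0)) = x k * c k"
  by (simp_all add: if_distrib[of "\<lambda>y. y * _"] if_distrib[of "\<lambda>y. _ * y"] sum.delta sum.delta' cong: if_cong)

lemma first_factor_mult:
  "eq_on_indices N (tensor_matrix_mult N (first_factor A) (first_factor B)) (first_factor (index_matrix_mult N A B))"
  by (simp add: eq_on_indices_def tensor_matrix_mult_def first_factor_def index_matrix_mult_def sum_delta_times)

lemma second_factor_mult:
  "eq_on_indices N (tensor_matrix_mult N (second_factor A) (second_factor B)) (second_factor (index_matrix_mult N A B))"
  unfolding eq_on_indices_def tensor_matrix_mult_def
  by (subst sum.swap) (simp add: second_factor_def index_matrix_mult_def sum_delta_times)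

lemma first_second_mult:
  "eq_on_indices N (tensor_matrix_mult N (first_factor A) (second_factor B)) (\<lambda>i j k l. A i j * B k l)"
  by (simp add: eq_on_indices_def tensor_matrix_mult_def first_factor_def second_factor_def sum_delta_times)

lemma second_first_mult:
  "eq_on_indices N (tensor_matrix_mult N (second_factor B) (first_factor A)) (\<lambda>i j k l. B k l * A i j)"
  by (simp add: eq_on_indices_def tensor_matrix_mult_def first_factor_def second_factor_def sum_delta_times)

lemma first_second_commute:
  assumes "\<And>i j k l. A i j * B k l = B k l * A i j"
  shows "eq_on_indices N (tensor_matrix_mult N (first_factor A) (second_factor B))
    (tensor_matrix_mult N (second_factor B) (first_factor A))"
  using first_second_mult[of N A B] second_first_mult[of N B A] assms by (simp add: eq_on_indices_def)

text \<open>The series \<open>t\<^bsub>ij\<^esub>(u)\<close> and \<open>t\<^bsub>ij\<^esub>(v)\<close>: \<open>1/u\<close> is the variable of the outer Laurent series, \<open>1/v\<close> that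
  of the inner ones.\<close>

definition T_outer :: "int \<Rightarrow> int \<Rightarrow> gen free fls fls" where
  "T_outer i j = fps_to_fls (Abs_fps (\<lambda>r. fls_const (letter (i, j, r))))"

definition T_inner :: "int \<Rightarrow> int \<Rightarrow> gen free fls fls" where
  "T_inner i j = fls_const (fps_to_fls (Abs_fps (\<lambda>r. letter (i, j, r))))"

lemma T_matrix_factors: "T1_matrix = first_factor T_outer" "T2_matrix = second_factor T_inner"
  by (auto simp: fun_eq_iff T1_matrix_def T2_matrix_def first_factor_def second_factor_def
      T_outer_def T_inner_def)

lemma (in ring_morphism) factors:
  "(\<lambda>i j k l. h (first_factor A i j k l)) = first_factor (\<lambda>i j. h (A i j))"
  "(\<lambda>i j k l. h (second_factor A i j k l)) = second_factor (\<lambda>i j. h (A i j))"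
  by (auto simp: fun_eq_iff first_factor_def second_factor_def zero)

text \<open>The matrices \<open>T(u)\<close> and \<open>T(v)\<close>, acting in the first and the second factor of the square of the
  matrix algebra, with entries in the left or in the right tensor factor of the coefficient ring.\<close>

abbreviation "left_T1 \<equiv> first_factor (\<lambda>i j. fls_map (fls_map inl_free) (T_outer i j))"
abbreviation "left_T2 \<equiv> second_factor (\<lambda>i j. fls_map (fls_map inl_free) (T_inner i j))"
abbreviation "right_T1 \<equiv> first_factor (\<lambda>i j. fls_map (fls_map inr_free) (T_outer i j))"
abbreviation "right_T2 \<equiv> second_factor (\<lambda>i j. fls_map (fls_map inr_free) (T_inner i j))"

lemma scalar_zero [simp]: "scalar 0 = 0"
  by (simp add: scalar_def)

lemma fls_map_zero: "h 0 = 0 \<Longrightarrow> fls_map h 0 = 0"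
  by (rule fls_eqI) (simp add: fls_nth_fls_map)

lemma fls_map_scalar:
  "fls_map (fls_map inl_free) (fls_map (fls_map scalar) f) = fls_map (fls_map (Poly_Mapping.single 0)) f"
  "fls_map (fls_map inr_free) (fls_map (fls_map scalar) f) = fls_map (fls_map (Poly_Mapping.single 0)) f"
  "fls_map (fls_map (comult N)) (fls_map (fls_map scalar) f) = fls_map (fls_map (Poly_Mapping.single 0)) f"
  by (intro fls_eqI,
      simp add: fls_nth_fls_map fls_map_zero inl_free_scalar inr_free_scalar comult_scalar)+

lemma comult_T_outer: "fls_map (fls_map (comult N)) (T_outer i j) =
    index_matrix_mult N (\<lambda>i j. fls_map (fls_map inl_free) (T_outer i j))
      (\<lambda>i j. fls_map (fls_map inr_free) (T_outer i j)) i j"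
proof -
  let ?a = "\<lambda>m s. fls_const (inl_free (letter (i, m, s)))"
  let ?b = "\<lambda>m s. fls_const (inr_free (letter (m, j, s)))"
  have "fls_map (fls_map (comult N)) (T_outer i j) =
      fps_to_fls (Abs_fps (\<lambda>r. \<Sum>m\<in>index_set N. \<Sum>s\<le>r. ?a m s * ?b m (r - s)))"
    by (simp add: T_outer_def fls_comult.fls_map_fps_to_fls comult_ring.fls_map_const comult_letter
        fls_const.sum)
  also have "\<dots> = (\<Sum>m\<in>index_set N. fps_to_fls (Abs_fps (?a m)) * fps_to_fls (Abs_fps (?b m)))"
    by (rule fps_to_fls_convolution)
  finally show ?thesis
    by (simp add: index_matrix_mult_def T_outer_def fls_inl.fls_map_fps_to_fls
        fls_inr.fls_map_fps_to_fls inl_ring.fls_map_const inr_ring.fls_map_const)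
qed

lemma comult_T_inner: "fls_map (fls_map (comult N)) (T_inner i j) =
    index_matrix_mult N (\<lambda>i j. fls_map (fls_map inl_free) (T_inner i j))
      (\<lambda>i j. fls_map (fls_map inr_free) (T_inner i j)) i j"
proof -
  let ?a = "\<lambda>m s. inl_free (letter (i, m, s))"
  let ?b = "\<lambda>m s. inr_free (letter (m, j, s))"
  have "fls_map (fls_map (comult N)) (T_inner i j) =
      fls_const (fps_to_fls (Abs_fps (\<lambda>r. \<Sum>m\<in>index_set N. \<Sum>s\<le>r. ?a m s * ?b m (r - s))))"
    by (simp add: T_inner_def fls_comult.fls_map_const comult_ring.fls_map_fps_to_fls comult_letter)
  also have "\<dots> = fls_const
      (\<Sum>m\<in>index_set N. fps_to_fls (Abs_fps (?a m)) * fps_to_fls (Abs_fps (?b m)))"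
    by (rule arg_cong[of _ _ fls_const], rule fps_to_fls_convolution)
  finally show ?thesis
    by (simp add: index_matrix_mult_def T_inner_def fls_inl.fls_map_const fls_inr.fls_map_const
        inl_ring.fls_map_fps_to_fls inr_ring.fls_map_fps_to_fls fls_const.sum)
qed

lemma comult_T1: "eq_on_indices N (\<lambda>i j k l. fls_map (fls_map (comult N)) (T1_matrix i j k l)) (tensor_matrix_mult N left_T1 right_T1)"
  unfolding T_matrix_factors fls2_comult.factors comult_T_outer
  by (rule eq_on_indices_sym[OF first_factor_mult])

lemma comult_T2: "eq_on_indices N (\<lambda>i j k l. fls_map (fls_map (comult N)) (T2_matrix i j k l)) (tensor_matrix_mult N left_T2 right_T2)"
  unfolding T_matrix_factors fls2_comult.factors comult_T_inner
  by (rule eq_on_indices_sym[OF second_factor_mult])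

lemma inl_inr_fls2_commute:
  "fls_map (fls_map inr_free) f * fls_map (fls_map inl_free) g =
    fls_map (fls_map inl_free) g * fls_map (fls_map inr_free) f"
  by (rule fls_times_commute)
    (simp, rule fls_times_commute, simp add: inr_times_inl)

lemma right_T1_left_T2: "eq_on_indices N (tensor_matrix_mult N right_T1 left_T2) (tensor_matrix_mult N left_T2 right_T1)"
  by (rule first_second_commute) (rule inl_inr_fls2_commute)

lemma right_T2_left_T1: "eq_on_indices N (tensor_matrix_mult N right_T2 left_T1) (tensor_matrix_mult N left_T1 right_T2)"
  by (rule eq_on_indices_sym, rule first_second_commute) (rule inl_inr_fls2_commute[symmetric])

lemma tensor_matrix_mult_diff:
  fixes A B C :: "'a::ring tensor_matrix"
  shows "tensor_matrix_mult N (\<lambda>i j k l. A i j k l - B i j k l) C i j k l =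
      tensor_matrix_mult N A C i j k l - tensor_matrix_mult N B C i j k l"
    "tensor_matrix_mult N C (\<lambda>i j k l. A i j k l - B i j k l) i j k l =
      tensor_matrix_mult N C A i j k l - tensor_matrix_mult N C B i j k l"
  by (simp_all add: tensor_matrix_mult_def left_diff_distrib right_diff_distrib sum_subtractf)

text \<open>As the entries of \<open>R(u - v)\<close> are scalar, a homomorphism changes only the matrices \<open>T(u)\<close> and
  \<open>T(v)\<close> in the relation.\<close>

lemma morphism_RTT_defect:
  assumes h: "ring_morphism h"
    and R: "\<And>f. h (fls_map (fls_map scalar) f) = fls_map (fls_map (Poly_Mapping.single 0)) f"
  shows "h (RTT_defect F N i j k l) =
    tensor_matrix_mult N (tensor_matrix_mult N (R_scalar F N) (\<lambda>i j k l. h (T1_matrix i j k l))) (\<lambda>i j k l. h (T2_matrix i j k l)) i j k l -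
    tensor_matrix_mult N (tensor_matrix_mult N (\<lambda>i j k l. h (T2_matrix i j k l)) (\<lambda>i j k l. h (T1_matrix i j k l))) (R_scalar F N) i j k l"
proof -
  interpret h: ring_morphism h by (rule h)
  show ?thesis
    by (simp add: RTT_defect_def Let_def h.diff h.tensor_matrix_mult R R_scalar_def[abs_def])
qed

text \<open>After exchanging commuting factors, \<open>R L\<^sub>1 L\<^sub>2 M\<^sub>1 M\<^sub>2 - L\<^sub>2 L\<^sub>1 M\<^sub>2 M\<^sub>1 R\<close> is to be evaluated, where \<open>L\<close> and
  \<open>M\<close> are \<open>T\<close> in the left and in the right tensor factor and the index is the factor of the square of
  the matrix algebra.  It equals \<open>(R L\<^sub>1 L\<^sub>2 - L\<^sub>2 L\<^sub>1 R) M\<^sub>1 M\<^sub>2 + L\<^sub>2 L\<^sub>1 (R M\<^sub>1 M\<^sub>2 - M\<^sub>2 M\<^sub>1 R)\<close>, because the term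
  \<open>L\<^sub>2 L\<^sub>1 R M\<^sub>1 M\<^sub>2\<close> occurs with both signs.\<close>

lemma comult_RTT_defect:
  assumes "i \<in> index_set N" "j \<in> index_set N" "k \<in> index_set N" "l \<in> index_set N"
  shows "fls_map (fls_map (comult N)) (RTT_defect F N i j k l) =
    tensor_matrix_mult N (\<lambda>i j k l. fls_map (fls_map inl_free) (RTT_defect F N i j k l))
      (tensor_matrix_mult N right_T1 right_T2) i j k l +
    tensor_matrix_mult N (tensor_matrix_mult N left_T2 left_T1)
      (\<lambda>i j k l. fls_map (fls_map inr_free) (RTT_defect F N i j k l)) i j k l"
proof -
  let ?m = "tensor_matrix_mult N" and ?R = "R_scalar F N"
  let ?C1 = "\<lambda>i j k l. fls_map (fls_map (comult N)) (T1_matrix i j k l)"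
  let ?C2 = "\<lambda>i j k l. fls_map (fls_map (comult N)) (T2_matrix i j k l)"
  have "eq_on_indices N (?m (?m ?R ?C1) ?C2) (?m (?m ?R (?m left_T1 right_T1)) (?m left_T2 right_T2))"
    by (intro eq_on_indices_mult comult_T1 comult_T2 eq_on_indices_refl)
  also have "?m (?m ?R (?m left_T1 right_T1)) (?m left_T2 right_T2) = ?m (?m ?R left_T1) (?m (?m right_T1 left_T2) right_T2)"
    by (simp add: tensor_matrix_mult_assoc)
  also have "eq_on_indices N \<dots> (?m (?m ?R left_T1) (?m (?m left_T2 right_T1) right_T2))"
    by (intro eq_on_indices_mult right_T1_left_T2 eq_on_indices_refl)
  finally have 1: "?m (?m ?R ?C1) ?C2 i j k l = ?m (?m (?m ?R left_T1) left_T2) (?m right_T1 right_T2) i j k l"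
    using assms by (simp add: eq_on_indices_def tensor_matrix_mult_assoc)
  have "eq_on_indices N (?m (?m ?C2 ?C1) ?R) (?m (?m (?m left_T2 right_T2) (?m left_T1 right_T1)) ?R)"
    by (intro eq_on_indices_mult comult_T1 comult_T2 eq_on_indices_refl)
  also have "?m (?m (?m left_T2 right_T2) (?m left_T1 right_T1)) ?R = ?m left_T2 (?m (?m right_T2 left_T1) (?m right_T1 ?R))"
    by (simp add: tensor_matrix_mult_assoc)
  also have "eq_on_indices N \<dots> (?m left_T2 (?m (?m left_T1 right_T2) (?m right_T1 ?R)))"
    by (intro eq_on_indices_mult right_T2_left_T1 eq_on_indices_refl)
  finally have 2: "?m (?m ?C2 ?C1) ?R i j k l = ?m (?m left_T2 left_T1) (?m (?m right_T2 right_T1) ?R) i j k l"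
    using assms by (simp add: eq_on_indices_def tensor_matrix_mult_assoc)
  have mid: "?m (?m (?m left_T2 left_T1) ?R) (?m right_T1 right_T2) i j k l = ?m (?m left_T2 left_T1) (?m (?m ?R right_T1) right_T2) i j k l"
    by (simp add: tensor_matrix_mult_assoc)
  show ?thesis
    unfolding morphism_RTT_defect[OF fls2_comult.ring_morphism_axioms fls_map_scalar(3)]
      morphism_RTT_defect[OF fls2_inl.ring_morphism_axioms fls_map_scalar(1)]
      morphism_RTT_defect[OF fls2_inr.ring_morphism_axioms fls_map_scalar(2)]
      T_matrix_factors fls2_inl.factors fls2_inr.factors fls2_comult.factors
      tensor_matrix_mult_diff 1[unfolded T_matrix_factors fls2_comult.factors]
      2[unfolded T_matrix_factors fls2_comult.factors] mid
    by (simp add: tensor_matrix_mult_assoc)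
qed

section \<open>Coefficients of Laurent series\<close>

lemma keys_diff_closed [simp]:
  "Poly_Mapping.keys p \<subseteq> S \<Longrightarrow> Poly_Mapping.keys q \<subseteq> S \<Longrightarrow> Poly_Mapping.keys (p - q) \<subseteq> S"
  for p q :: "'k \<Rightarrow>\<^sub>0 complex"
  unfolding diff_conv_add_uminus uminus_eq_scl by simp

lemma add_closed_monoid_alg: "add_closed (carrier (monoid_alg S))"
  by (simp add: add_closed_def)

lemma fls_over_fps_to_fls: "0 \<in> S \<Longrightarrow> (\<And>n. f $ n \<in> S) \<Longrightarrow> fps_to_fls f \<in> fls_over S"
  by (simp add: fls_over_def)

lemma fls_over_const: "0 \<in> S \<Longrightarrow> c \<in> S \<Longrightarrow> fls_const c \<in> fls_over S"
  by (simp add: fls_over_def)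

section \<open>The coproduct of the extended Yangian\<close>

locale yangian =
  fixes F :: family and N :: nat
begin

abbreviation "G \<equiv> generators N"
abbreviation "Fr \<equiv> free_alg G"
abbreviation "FF \<equiv> monoid_alg (words G \<times> words G)"
abbreviation "X \<equiv> X_alg F N"
abbreviation "J \<equiv> yangian_ideal F N"
abbreviation "proj \<equiv> X_proj F N"

sublocale Fr: unital_algebra Fr by (rule unital_algebra_free_alg)

lemma words_pair: "0 \<in> words G \<times> words G"
  "\<And>x y. x \<in> words G \<times> words G \<Longrightarrow> y \<in> words G \<times> words G \<Longrightarrow> x + y \<in> words G \<times> words G"
  by (auto simp: zero_prod_def)

sublocale FF: unital_algebra FF by (rule unital_algebra_monoid_alg[OF words_pair])

lemma inl_hom: "unital_algebra_hom Fr FF inl_free"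
proof
  fix p assume "p \<in> carrier Fr"
  then show "inl_free p \<in> carrier FF"
    unfolding free_alg_eq inl_free_def monoid_alg_simps
    by (intro order.trans[OF keys_lin_ext]) auto
qed (simp_all add: free_alg_eq inl_ring.add inl_ring.mult inl_ring.one, simp add: inl_free_def lin_ext_scl)

lemma inr_hom: "unital_algebra_hom Fr FF inr_free"
proof
  fix p assume "p \<in> carrier Fr"
  then show "inr_free p \<in> carrier FF"
    unfolding free_alg_eq inr_free_def monoid_alg_simps
    by (intro order.trans[OF keys_lin_ext]) auto
qed (simp_all add: free_alg_eq inr_ring.add inr_ring.mult inr_ring.one, simp add: inr_free_def lin_ext_scl)

sublocale inl: unital_algebra_hom Fr FF inl_free by (rule inl_hom)
sublocale inr: unital_algebra_hom Fr FF inr_free by (rule inr_hom)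

lemma FF_times_closed: "p \<in> carrier FF \<Longrightarrow> q \<in> carrier FF \<Longrightarrow> p * q \<in> carrier FF"
  using FF.m_closed[of p q] by (simp del: monoid_alg_simps(1))

lemma comult_letter_closed:
  assumes "g \<in> G"
  shows "comult_letter N g \<in> carrier FF"
proof -
  obtain i j r where g: "g = (i, j, r)" "i \<in> index_set N" "j \<in> index_set N"
    using assms by (auto simp: generators_def)
  show ?thesis
    unfolding g comult_letter_def prod.case
    by (intro add_closed_sum[OF add_closed_monoid_alg] FF_times_closed inl.hom_closed inr.hom_closed
        letter_closed)
      (use g in \<open>auto simp: generators_def\<close>)
qed

sublocale comult: unital_algebra_hom Fr FF "comult N"
  unfolding comult_def using words_pair comult_letter_closed by (rule free_hom_closed)

lemma Fr_simps: "add Fr = (+)" "mult Fr = (*)" "zero Fr = 0" "one Fr = 1" "smult Fr = scl"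
  by (simp_all add: free_alg_eq)

lemma add_closed_Fr: "add_closed (carrier Fr)"
  unfolding free_alg_eq by (rule add_closed_monoid_alg)

lemma Fr_times_closed: "p \<in> carrier Fr \<Longrightarrow> q \<in> carrier Fr \<Longrightarrow> p * q \<in> carrier Fr"
  using Fr.m_closed[of p q] by (simp add: Fr_simps)

lemma Fr_diff_closed: "p \<in> carrier Fr \<Longrightarrow> q \<in> carrier Fr \<Longrightarrow> p - q \<in> carrier Fr"
  by (simp add: free_alg_eq)

lemma scalar_closed: "scalar c \<in> carrier Fr"
  by (simp add: free_alg_eq scalar_def)

lemma fls_map_scalar_closed: "fls_map scalar f \<in> fls_over (carrier Fr)"
  by (auto simp: fls_over_def fls_nth_fls_map scalar_closed)

abbreviation "Fr2 \<equiv> fls_over (fls_over (carrier Fr))"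

lemma T_closed:
  assumes "i \<in> index_set N" "j \<in> index_set N"
  shows "T_outer i j \<in> Fr2" "T_inner i j \<in> Fr2"
proof -
  have [simp]: "0 \<in> fls_over (carrier Fr)" "0 \<in> carrier Fr"
    by (auto simp: fls_over_def free_alg_eq)
  have "letter (i, j, r) \<in> carrier Fr" for r
    using assms by (intro letter_closed) (simp add: generators_def)
  then show "T_outer i j \<in> Fr2" "T_inner i j \<in> Fr2"
    unfolding T_outer_def T_inner_def by (auto intro!: fls_over_fps_to_fls fls_over_const)
qed

lemma Fr2_zero: "0 \<in> Fr2"
  by (auto simp: fls_over_def free_alg_eq)

lemma Fr2_times: "f \<in> Fr2 \<Longrightarrow> g \<in> Fr2 \<Longrightarrow> f * g \<in> Fr2"
  by (rule fls_over_times[OF add_closed_fls_over[OF add_closed_Fr] fls_over_times[OF add_closed_Fr Fr_times_closed]])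

lemma RTT_defect_closed:
  assumes "i \<in> index_set N" "j \<in> index_set N" "k \<in> index_set N" "l \<in> index_set N"
  shows "RTT_defect F N i j k l \<in> Fr2"
proof -
  have R: "fls_map (fls_map scalar) f \<in> Fr2" for f
    by (auto simp: fls_over_def fls_nth_fls_map fls_map_zero scalar_closed)
  have T: "T1_matrix i j k l \<in> Fr2" "T2_matrix i j k l \<in> Fr2"
    if "i \<in> index_set N" "j \<in> index_set N" "k \<in> index_set N" "l \<in> index_set N" for i j k l
    using that T_closed Fr2_zero unfolding T_matrix_factors by (auto simp: first_factor_def second_factor_def)
  have mult: "tensor_matrix_mult N A B i j k l \<in> Fr2"
    if "\<And>i j k l. i \<in> index_set N \<Longrightarrow> j \<in> index_set N \<Longrightarrow> k \<in> index_set N \<Longrightarrow> l \<in> index_set N \<Longrightarrow> A i j k l \<in> Fr2"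
      "\<And>i j k l. i \<in> index_set N \<Longrightarrow> j \<in> index_set N \<Longrightarrow> k \<in> index_set N \<Longrightarrow> l \<in> index_set N \<Longrightarrow> B i j k l \<in> Fr2"
      "i \<in> index_set N" "j \<in> index_set N" "k \<in> index_set N" "l \<in> index_set N" for A B i j k l
    by (rule tensor_matrix_mult_over[OF add_closed_fls_over[OF add_closed_fls_over[OF add_closed_Fr]] Fr2_times])
      (use that in auto)
  have diff: "f - g \<in> Fr2" if "f \<in> Fr2" "g \<in> Fr2" for f g
    using that Fr_diff_closed by (simp add: fls_over_def)
  show ?thesis
    unfolding RTT_defect_def Let_def
    by (intro diff mult R T assms)
qed

lemma relations_closed: "yangian_relations F N \<subseteq> carrier Fr"
proof -
  have "letter (i, j, 0) - (if i = j then 1 else 0) \<in> carrier Fr"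
    if "i \<in> index_set N" "j \<in> index_set N" for i j
  proof -
    have "(i, j, 0) \<in> G" using that by (simp add: generators_def)
    moreover have "(if i = j then 1 else 0) \<in> carrier Fr"
      using Fr.one_closed Fr.zero_closed by (simp add: Fr_simps)
    ultimately show ?thesis by (intro Fr_diff_closed letter_closed)
  qed
  moreover have "RTT_defect F N i j k l $$ m $$ n \<in> carrier Fr"
    if "i \<in> index_set N" "j \<in> index_set N" "k \<in> index_set N" "l \<in> index_set N" for i j k l m n
    using RTT_defect_closed[OF that] by (simp add: fls_over_def)
  ultimately show ?thesis
    unfolding yangian_relations_def
    by (intro Un_least subsetI) (elim CollectE exE conjE; simp only:)+
qed

lemma ideal_J: "ideal J Fr"
  unfolding yangian_ideal_def by (rule Fr.genideal_ideal[OF relations_closed])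

lemma relations_subset_J: "yangian_relations F N \<subseteq> J"
  unfolding yangian_ideal_def by (rule Fr.genideal_self[OF relations_closed])

lemma unital_algebra_X: "unital_algebra X"
  unfolding X_alg_def by (rule Fr.unital_algebra_quotient_alg[OF ideal_J])

sublocale X: unital_algebra X by (rule unital_algebra_X)

lemma proj_hom: "unital_algebra_hom Fr X proj"
  unfolding X_alg_def X_proj_def[abs_def] by (rule Fr.coset_hom[OF ideal_J])

sublocale proj: unital_algebra_hom Fr X proj by (rule proj_hom)

lemma carrier_X: "carrier X = proj ` carrier Fr"
  by (simp add: X_alg_def carrier_quotient_alg X_proj_def[abs_def])

lemma proj_zero_iff: "p \<in> carrier Fr \<Longrightarrow> proj p = \<zero>\<^bsub>X\<^esub> \<longleftrightarrow> p \<in> J"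
  unfolding X_alg_def X_proj_def by (rule Fr.coset_eq_zero_iff[OF ideal_J])

sublocale XX: tensor_product X X ..

abbreviation "XX \<equiv> XX_alg F N"
abbreviation "pure \<equiv> pure_tensor X X"

definition pair_word :: "gen word \<times> gen word \<Rightarrow> gen free set \<times> gen free set" where
  "pair_word x = (proj (Poly_Mapping.single (fst x) 1), proj (Poly_Mapping.single (snd x) 1))"

text \<open>The projection of the tensor square of the free algebra onto \<open>X \<otimes> X\<close>, defined on pairs of words
  and extended linearly; by \<open>tensor_proj_pure\<close> it is the tensor square of the projection onto \<open>X\<close>.\<close>

definition tensor_proj :: "gen free2 \<Rightarrow> ((gen free set \<times> gen free set) \<Rightarrow>\<^sub>0 complex) set" where
  "tensor_proj b = tensor_null X X +>\<^bsub>pair_alg X X\<^esub> lin_ext (\<lambda>x. Poly_Mapping.single (pair_word x) 1) b"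

lemma word_closed: "w \<in> words G \<Longrightarrow> Poly_Mapping.single w c \<in> carrier Fr"
  by (simp add: free_alg_eq)

lemma tensor_proj_hom: "unital_algebra_hom FF XX tensor_proj"
  unfolding XX_alg_def tensor_proj_def[abs_def]
proof (rule unital_algebra_hom_comp[OF _ XX.tensor_coset_hom])
  show "unital_algebra_hom FF (pair_alg X X) (lin_ext (\<lambda>x. Poly_Mapping.single (pair_word x) 1))"
  proof (rule XX.lin_ext_pair_hom[OF words_pair])
    fix x y assume x: "x \<in> words G \<times> words G"
    show "pair_word x \<in> carrier X \<times> carrier X"
      using x by (auto simp: pair_word_def word_closed)
    assume y: "y \<in> words G \<times> words G"
    have "Poly_Mapping.single (v + w) 1 = Poly_Mapping.single v 1 \<otimes>\<^bsub>Fr\<^esub> Poly_Mapping.single w (1::complex)"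
      for v w :: "gen word" by (simp add: Fr_simps mult_single)
    then show "pair_word (x + y) = (fst (pair_word x) \<otimes>\<^bsub>X\<^esub> fst (pair_word y),
        snd (pair_word x) \<otimes>\<^bsub>X\<^esub> snd (pair_word y))"
      using x y by (auto simp: pair_word_def word_closed)
  next
    show "pair_word 0 = (\<one>\<^bsub>X\<^esub>, \<one>\<^bsub>X\<^esub>)"
      using proj.hom_one by (simp add: pair_word_def Fr_simps)
  qed
qed

sublocale tensor_proj: unital_algebra_hom FF XX tensor_proj by (rule tensor_proj_hom)

text \<open>Two homomorphisms on the free algebra that agree on words.\<close>

lemma tensor_proj_inl:
  assumes "p \<in> carrier Fr"
  shows "tensor_proj (inl_free p) = pure (proj p) \<one>\<^bsub>X\<^esub>"
proof (rule hom_eq_on_basis)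
  show "unital_algebra_hom (monoid_alg (words G)) XX (\<lambda>p. tensor_proj (inl_free p))"
    using unital_algebra_hom_comp[OF inl_hom tensor_proj_hom] by (simp add: free_alg_eq)
  show "unital_algebra_hom (monoid_alg (words G)) XX (\<lambda>p. pure (proj p) \<one>\<^bsub>X\<^esub>)"
    using unital_algebra_hom_comp[OF proj_hom XX.pure_left_hom] by (simp add: free_alg_eq XX_alg_def)
  show "p \<in> carrier (monoid_alg (words G))" using assms by (simp add: free_alg_eq)
  show "tensor_proj (inl_free (Poly_Mapping.single w 1)) = pure (proj (Poly_Mapping.single w 1)) \<one>\<^bsub>X\<^esub>" for w
    using proj.hom_one by (simp add: inl_free_def tensor_proj_def pair_word_def pure_tensor_def Fr_simps)
qed

lemma tensor_proj_inr:
  assumes "p \<in> carrier Fr"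
  shows "tensor_proj (inr_free p) = pure \<one>\<^bsub>X\<^esub> (proj p)"
proof (rule hom_eq_on_basis)
  show "unital_algebra_hom (monoid_alg (words G)) XX (\<lambda>p. tensor_proj (inr_free p))"
    using unital_algebra_hom_comp[OF inr_hom tensor_proj_hom] by (simp add: free_alg_eq)
  show "unital_algebra_hom (monoid_alg (words G)) XX (\<lambda>p. pure \<one>\<^bsub>X\<^esub> (proj p))"
    using unital_algebra_hom_comp[OF proj_hom XX.pure_right_hom] by (simp add: free_alg_eq XX_alg_def)
  show "p \<in> carrier (monoid_alg (words G))" using assms by (simp add: free_alg_eq)
  show "tensor_proj (inr_free (Poly_Mapping.single w 1)) = pure \<one>\<^bsub>X\<^esub> (proj (Poly_Mapping.single w 1))" for w
    using proj.hom_one by (simp add: inr_free_def tensor_proj_def pair_word_def pure_tensor_def Fr_simps)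
qed

lemma tensor_proj_pure:
  assumes "p \<in> carrier Fr" "q \<in> carrier Fr"
  shows "tensor_proj (inl_free p * inr_free q) = pure (proj p) (proj q)"
  using tensor_proj.hom_mult[OF inl.hom_closed[OF assms(1)] inr.hom_closed[OF assms(2)]] assms
    XX.pure_tensor_mult[of "proj p" "\<one>\<^bsub>X\<^esub>" "\<one>\<^bsub>X\<^esub>" "proj q"]
  by (simp add: tensor_proj_inl tensor_proj_inr XX_alg_def)

lemma unital_algebra_XX: "unital_algebra XX"
  unfolding XX_alg_def by (rule XX.unital_algebra_tensor_alg)

definition Ker :: "gen free2 set" where
  "Ker = {b \<in> carrier FF. tensor_proj b = \<zero>\<^bsub>XX\<^esub>}"

lemma ideal_Ker: "ideal Ker FF"
  unfolding Ker_def by (rule tensor_proj.ideal_kernel)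

lemma Ker_times:
  assumes "p \<in> Ker" "q \<in> carrier FF"
  shows "p * q \<in> Ker" "q * p \<in> Ker"
  using ideal.I_r_closed[OF ideal_Ker assms] ideal.I_l_closed[OF ideal_Ker assms] by simp_all

lemma add_closed_Ker: "add_closed Ker"
  using additive_subgroup.a_closed[OF ideal.axioms(1)[OF ideal_Ker]]
    additive_subgroup.zero_closed[OF ideal.axioms(1)[OF ideal_Ker]]
  by (simp add: add_closed_def)

lemma inl_J_Ker:
  assumes "p \<in> J" shows "inl_free p \<in> Ker"
proof -
  have p: "p \<in> carrier Fr" using ideal.Icarr[OF ideal_J assms] .
  have "tensor_proj (inl_free p) = pure \<zero>\<^bsub>X\<^esub> \<one>\<^bsub>X\<^esub>"
    using proj_zero_iff[OF p] assms by (simp add: tensor_proj_inl[OF p])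
  also have "\<dots> = \<zero>\<^bsub>XX\<^esub>"
    using unital_algebra_hom.hom_zero[OF XX.pure_left_hom] by (simp add: XX_alg_def)
  finally show ?thesis using inl.hom_closed[OF p] by (simp add: Ker_def)
qed

lemma inr_J_Ker:
  assumes "p \<in> J" shows "inr_free p \<in> Ker"
proof -
  have p: "p \<in> carrier Fr" using ideal.Icarr[OF ideal_J assms] .
  have "tensor_proj (inr_free p) = pure \<one>\<^bsub>X\<^esub> \<zero>\<^bsub>X\<^esub>"
    using proj_zero_iff[OF p] assms by (simp add: tensor_proj_inr[OF p])
  also have "\<dots> = \<zero>\<^bsub>XX\<^esub>"
    using unital_algebra_hom.hom_zero[OF XX.pure_right_hom] by (simp add: XX_alg_def)
  finally show ?thesis using inr.hom_closed[OF p] by (simp add: Ker_def)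
qed

abbreviation "FF2 \<equiv> fls_over (fls_over (carrier FF))"
abbreviation "Ker2 \<equiv> fls_over (fls_over Ker)"

lemma fls2_map_closed:
  assumes "h 0 = 0" "\<And>x. x \<in> S \<Longrightarrow> h x \<in> S'" "f \<in> fls_over (fls_over S)"
  shows "fls_map (fls_map h) f \<in> fls_over (fls_over S')"
  using assms by (auto simp: fls_over_def fls_nth_fls_map fls_map_zero)

lemma FF2_zero: "0 \<in> FF2"
  by (simp add: fls_over_def)

lemma FF2_times: "f \<in> FF2 \<Longrightarrow> g \<in> FF2 \<Longrightarrow> f * g \<in> FF2"
  by (rule fls_over_times[OF add_closed_fls_over[OF add_closed_monoid_alg]
        fls_over_times[OF add_closed_monoid_alg FF_times_closed]])

lemma Ker2_times:
  assumes "f \<in> Ker2" "g \<in> FF2"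
  shows "f * g \<in> Ker2" "g * f \<in> Ker2"
proof -
  have 1: "f * g \<in> fls_over Ker" "g * f \<in> fls_over Ker"
    if "f \<in> fls_over Ker" "g \<in> fls_over (carrier FF)" for f g
    using fls_over_times[OF add_closed_Ker Ker_times(1) that]
      fls_over_times[OF add_closed_Ker Ker_times(2) that(2,1)] by blast+
  show "f * g \<in> Ker2" "g * f \<in> Ker2"
    using fls_over_times[OF add_closed_fls_over[OF add_closed_Ker] 1(1) assms]
      fls_over_times[OF add_closed_fls_over[OF add_closed_Ker] 1(2) assms(2,1)] by blast+
qed

lemma factors_closed:
  assumes "i \<in> index_set N" "j \<in> index_set N" "k \<in> index_set N" "l \<in> index_set N"
  shows "left_T1 i j k l \<in> FF2" "left_T2 i j k l \<in> FF2" "right_T1 i j k l \<in> FF2" "right_T2 i j k l \<in> FF2"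
proof -
  have "fls_map (fls_map inl_free) f \<in> FF2" "fls_map (fls_map inr_free) f \<in> FF2" if "f \<in> Fr2" for f
    using that inl.hom_closed inr.hom_closed
    by (auto intro!: fls2_map_closed[of _ "carrier Fr"] simp: inl_ring.zero inr_ring.zero
        simp del: monoid_alg_simps(1))
  then show "left_T1 i j k l \<in> FF2" "left_T2 i j k l \<in> FF2" "right_T1 i j k l \<in> FF2" "right_T2 i j k l \<in> FF2"
    using assms T_closed FF2_zero by (simp_all add: first_factor_def second_factor_def)
qed

text \<open>Both terms of \<open>comult_RTT_defect\<close> contain a factor whose coefficients are killed by \<open>tensor_proj\<close>.\<close>

lemma comult_RTT_defect_Ker:
  assumes ijkl: "i \<in> index_set N" "j \<in> index_set N" "k \<in> index_set N" "l \<in> index_set N"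
  shows "comult N (RTT_defect F N i j k l $$ m $$ n) \<in> Ker"
proof -
  have add2: "add_closed FF2" "add_closed Ker2"
    by (intro add_closed_fls_over add_closed_monoid_alg add_closed_Ker)+
  have RTT: "RTT_defect F N i j k l \<in> fls_over (fls_over J)"
    if "i \<in> index_set N" "j \<in> index_set N" "k \<in> index_set N" "l \<in> index_set N" for i j k l
    using relations_subset_J that unfolding yangian_relations_def fls_over_def by blast
  have left: "tensor_matrix_mult N (\<lambda>i j k l. fls_map (fls_map inl_free) (RTT_defect F N i j k l))
      (tensor_matrix_mult N right_T1 right_T2) i j k l \<in> Ker2"
    by (rule tensor_matrix_mult_over[OF add2(2) Ker2_times(1)])
      (use ijkl in \<open>auto intro!: fls2_map_closed[OF _ inl_J_Ker RTT] inl_ring.zero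
        tensor_matrix_mult_over[OF add2(1) FF2_times] factors_closed\<close>)
  have right: "tensor_matrix_mult N (tensor_matrix_mult N left_T2 left_T1)
      (\<lambda>i j k l. fls_map (fls_map inr_free) (RTT_defect F N i j k l)) i j k l \<in> Ker2"
    by (rule tensor_matrix_mult_over[OF add2(2) Ker2_times(2)])
      (use ijkl in \<open>auto intro!: fls2_map_closed[OF _ inr_J_Ker RTT] inr_ring.zero
        tensor_matrix_mult_over[OF add2(1) FF2_times] factors_closed\<close>)
  have "fls_map (fls_map (comult N)) (RTT_defect F N i j k l) \<in> Ker2"
    unfolding comult_RTT_defect[OF ijkl] using left right add2(2) by (auto simp: add_closed_def)
  then show ?thesis by (simp add: fls_over_def)
qed

text \<open>With \<open>t\<^sub>0\<close> the matrix of the elements \<open>t\<^bsub>ij\<^esub>\<^bsup>(0)\<^esup>\<close>, this is the identity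
  \<open>t\<^sub>0 \<otimes> t\<^sub>0 - I = (t\<^sub>0 - I) \<otimes> t\<^sub>0 + I \<otimes> (t\<^sub>0 - I)\<close>.\<close>

lemma comult_letter_zero_Ker:
  assumes ij: "i \<in> index_set N" "j \<in> index_set N"
  shows "comult N (letter (i, j, 0) - (if i = j then 1 else 0)) \<in> Ker"
proof -
  let ?d = "\<lambda>i j. if i = j then 1 else 0 :: gen free"
  let ?e = "\<lambda>i j. letter (i, j, 0) - ?d i j"
  have e: "?e i j \<in> J" if "i \<in> index_set N" "j \<in> index_set N" for i j
    using relations_subset_J that unfolding yangian_relations_def by blast
  have d: "(\<Sum>k\<in>index_set N. inl_free (?d i k) * inr_free (letter (k, j, 0))) = inr_free (letter (i, j, 0))"
    using ij sum_delta_times(1)[of "index_set N" i "\<lambda>_. 1" "\<lambda>k. inr_free (letter (k, j, 0))"]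
    by (simp add: if_distrib[of inl_free] inl_ring.one inl_ring.zero cong: if_cong)
  have "comult N (letter (i, j, 0)) = (\<Sum>k\<in>index_set N. inl_free (letter (i, k, 0)) * inr_free (letter (k, j, 0)))"
    by (simp add: comult_letter)
  also have "\<dots> = (\<Sum>k\<in>index_set N. inl_free (?e i k) * inr_free (letter (k, j, 0))
      + inl_free (?d i k) * inr_free (letter (k, j, 0)))"
    by (rule sum.cong) (simp_all only: inl_ring.diff left_diff_distrib diff_add_cancel)
  also have "\<dots> = (\<Sum>k\<in>index_set N. inl_free (?e i k) * inr_free (letter (k, j, 0)))
      + inr_free (letter (i, j, 0))"
    by (simp only: sum.distrib d)
  finally have "comult N (?e i j) = (\<Sum>k\<in>index_set N. inl_free (?e i k) * inr_free (letter (k, j, 0)))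
      + inr_free (?e i j)"
    by (simp add: comult_ring.diff inr_ring.diff comult_ring.one comult_ring.zero inr_ring.one inr_ring.zero)
  moreover have "(\<Sum>k\<in>index_set N. inl_free (?e i k) * inr_free (letter (k, j, 0))) \<in> Ker"
    using ij by (intro add_closed_sum[OF add_closed_Ker] Ker_times inl_J_Ker e inr.hom_closed letter_closed)
      (simp_all add: generators_def)
  moreover have "inr_free (?e i j) \<in> Ker" using ij by (intro inr_J_Ker e)
  ultimately show ?thesis using add_closed_Ker by (simp add: add_closed_def)
qed

lemma comult_J_Ker:
  assumes "p \<in> J" shows "comult N p \<in> Ker"
proof -
  interpret D: unital_algebra_hom Fr XX "\<lambda>p. tensor_proj (comult N p)"
    by (rule unital_algebra_hom_comp[OF comult.unital_algebra_hom_axioms tensor_proj_hom])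
  have "yangian_relations F N \<subseteq> {p \<in> carrier Fr. tensor_proj (comult N p) = \<zero>\<^bsub>XX\<^esub>}"
  proof
    fix p assume p: "p \<in> yangian_relations F N"
    then have "comult N p \<in> Ker"
      using comult_letter_zero_Ker comult_RTT_defect_Ker unfolding yangian_relations_def by blast
    then show "p \<in> {p \<in> carrier Fr. tensor_proj (comult N p) = \<zero>\<^bsub>XX\<^esub>}"
      using p relations_closed by (auto simp: Ker_def)
  qed
  then have "J \<subseteq> {p \<in> carrier Fr. tensor_proj (comult N p) = \<zero>\<^bsub>XX\<^esub>}"
    unfolding yangian_ideal_def by (rule Fr.genideal_minimal[OF D.ideal_kernel])
  then show ?thesis using assms comult.hom_closed by (auto simp: Ker_def simp del: monoid_alg_simps(1))
qed

lemma coproduct_gen_eq: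
  assumes "g \<in> G"
  shows "coproduct_gen F N g = tensor_proj (comult_letter N g)"
proof -
  obtain i j r where g: "g = (i, j, r)" "i \<in> index_set N" "j \<in> index_set N"
    using assms by (auto simp: generators_def)
  let ?f = "\<lambda>k s. inl_free (letter (i, k, s)) * inr_free (letter (k, j, r - s))"
  have l: "letter (i, k, s) \<in> carrier Fr" "letter (k, j, s) \<in> carrier Fr" if "k \<in> index_set N" for k s
    using g that by (auto intro!: letter_closed simp: generators_def)
  have f: "?f k s \<in> carrier FF" if "k \<in> index_set N" for k s
    using l that by (intro FF_times_closed inl.hom_closed inr.hom_closed)
  have sum_f: "(\<Sum>s\<le>r. ?f k s) \<in> carrier FF" if "k \<in> index_set N" for k
    using f[OF that] by (rule add_closed_sum[OF add_closed_monoid_alg])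
  have inner: "tensor_proj (\<Sum>s\<le>r. ?f k s) = (\<Oplus>\<^bsub>XX\<^esub>s\<in>{..r}. pure (proj (letter (i, k, s))) (proj (letter (k, j, r - s))))"
    if k: "k \<in> index_set N" for k
  proof -
    have "tensor_proj (\<Sum>s\<le>r. ?f k s) = tensor_proj (\<Oplus>\<^bsub>FF\<^esub>s\<in>{..r}. ?f k s)"
      using f[OF k] by (subst finsum_monoid_alg[OF FF.unital_algebra_axioms]) auto
    also have "\<dots> = (\<Oplus>\<^bsub>XX\<^esub>s\<in>{..r}. tensor_proj (?f k s))"
      using f[OF k] by (intro tensor_proj.hom_finsum) auto
    also have "\<dots> = (\<Oplus>\<^bsub>XX\<^esub>s\<in>{..r}. pure (proj (letter (i, k, s))) (proj (letter (k, j, r - s))))"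
      by (simp only: tensor_proj_pure[OF l[OF k]])
    finally show ?thesis .
  qed
  have "tensor_proj (comult_letter N g) = tensor_proj (\<Oplus>\<^bsub>FF\<^esub>k\<in>index_set N. \<Sum>s\<le>r. ?f k s)"
    unfolding g comult_letter_def prod.case
    using sum_f by (subst finsum_monoid_alg[OF FF.unital_algebra_axioms]) auto
  also have "\<dots> = (\<Oplus>\<^bsub>XX\<^esub>k\<in>index_set N. tensor_proj (\<Sum>s\<le>r. ?f k s))"
    using sum_f by (intro tensor_proj.hom_finsum) auto
  also have "\<dots> = coproduct_gen F N g"
    unfolding g coproduct_gen_def prod.case
  proof (rule tensor_proj.B.finsum_cong')
    show "(\<lambda>k. \<Oplus>\<^bsub>XX\<^esub>s\<in>{..r}. pure (proj (letter (i, k, s))) (proj (letter (k, j, r - s))))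
        \<in> index_set N \<rightarrow> carrier XX"
      using tensor_proj.hom_closed[OF sum_f] inner by (metis (no_types, lifting) Pi_I)
  qed (simp_all add: inner)
  finally show ?thesis ..
qed

text \<open>On the coset of \<open>p\<close>, the lift from the free algebra has the single value \<open>tensor_proj (comult N p)\<close>,
  since \<open>comult\<close> maps the defining ideal into the kernel of \<open>tensor_proj\<close>.\<close>

lemma coproduct_proj:
  assumes p: "p \<in> carrier Fr"
  shows "coproduct F N (proj p) = tensor_proj (comult N p)"
proof -
  have lift: "free_lift XX (coproduct_gen F N) q = tensor_proj (comult N q)" if "q \<in> carrier Fr" for q
    unfolding comult_def
    by (rule free_lift_eq_hom[OF tensor_proj_hom words_pair comult_letter_closed coproduct_gen_eq that])
  have coset: "q \<in> carrier Fr \<and> tensor_proj (comult N q) = tensor_proj (comult N p)" if "q \<in> proj p" for q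
  proof -
    from that obtain j where j: "j \<in> J" "q = j + p"
      unfolding X_proj_def a_r_coset_def' by (auto simp: Fr_simps)
    have jc: "j \<in> carrier Fr" using ideal.Icarr[OF ideal_J j(1)] .
    have "tensor_proj (comult N q) = tensor_proj (comult N j) \<oplus>\<^bsub>XX\<^esub> tensor_proj (comult N p)"
      using tensor_proj.hom_add[OF comult.hom_closed[OF jc] comult.hom_closed[OF p]]
      by (simp add: j comult_ring.add)
    also have "\<dots> = tensor_proj (comult N p)"
      using comult_J_Ker[OF j(1)] tensor_proj.hom_closed[OF comult.hom_closed[OF p]] tensor_proj.B.l_zero
      by (simp add: Ker_def)
    finally show ?thesis using Fr.a_closed[OF jc p] by (simp add: j Fr_simps)
  qed
  have "p \<in> proj p"
    unfolding X_proj_def by (rule abelian_subgroup.a_rcos_self[OF _ p])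
      (rule abelian_subgroupI3[OF ideal.axioms(1)[OF ideal_J] Fr.abelian_group_axioms])
  then have "(\<lambda>_. tensor_proj (comult N p)) ` proj p = {tensor_proj (comult N p)}"
    by (rule image_constant)
  moreover have "free_lift XX (coproduct_gen F N) ` proj p = (\<lambda>_. tensor_proj (comult N p)) ` proj p"
    by (rule image_cong[OF refl]) (use coset lift in simp)
  ultimately have "free_lift XX (coproduct_gen F N) ` proj p = {tensor_proj (comult N p)}" by simp
  then show ?thesis by (simp add: coproduct_def)
qed

lemma coproduct_hom: "unital_algebra_hom X XX (coproduct F N)"
proof (intro unital_algebra_hom.intro unital_algebra_hom_axioms.intro)
  interpret D: unital_algebra_hom Fr XX "\<lambda>p. tensor_proj (comult N p)"
    by (rule unital_algebra_hom_comp[OF comult.unital_algebra_hom_axioms tensor_proj_hom])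
  show "unital_algebra X" "unital_algebra XX" by (rule unital_algebra_X unital_algebra_XX)+
  show "coproduct F N \<one>\<^bsub>X\<^esub> = \<one>\<^bsub>XX\<^esub>"
    using coproduct_proj[OF Fr.one_closed] D.hom_one proj.hom_one by simp
  fix x assume "x \<in> carrier X"
  then obtain p where p: "p \<in> carrier Fr" "x = proj p" by (auto simp: carrier_X)
  show "coproduct F N x \<in> carrier XX"
    using coproduct_proj[OF p(1)] D.hom_closed[OF p(1)] by (simp add: p)
  show "coproduct F N (c \<odot>\<^bsub>X\<^esub> x) = c \<odot>\<^bsub>XX\<^esub> coproduct F N x" for c
    using p coproduct_proj[OF p(1)] D.hom_scale[OF p(1)]
      coproduct_proj[OF Fr.scale_closed[OF p(1), of c]] proj.hom_scale[OF p(1), of c] by metis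
  fix y assume "y \<in> carrier X"
  then obtain q where q: "q \<in> carrier Fr" "y = proj q" by (auto simp: carrier_X)
  show "coproduct F N (x \<oplus>\<^bsub>X\<^esub> y) = coproduct F N x \<oplus>\<^bsub>XX\<^esub> coproduct F N y"
    using p q coproduct_proj D.hom_add[OF p(1) q(1)] proj.hom_add[OF p(1) q(1)]
      Fr.a_closed[OF p(1) q(1)] by metis
  show "coproduct F N (x \<otimes>\<^bsub>X\<^esub> y) = coproduct F N x \<otimes>\<^bsub>XX\<^esub> coproduct F N y"
    using p q coproduct_proj D.hom_mult[OF p(1) q(1)] proj.hom_mult[OF p(1) q(1)]
      Fr.m_closed[OF p(1) q(1)] by metis
qed

end

section \<open>Substituting a power series for the spectral parameter\<close>

text \<open>The value at \<open>1/u = Y\<close> of the series with coefficients \<open>a r\<close>.  For \<open>Y\<close> without constant term, terms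
  of order above \<open>n\<close> do not contribute to the coefficient of order \<open>n\<close>.\<close>

definition fps_subst :: "complex fps \<Rightarrow> (nat \<Rightarrow> ('k \<Rightarrow>\<^sub>0 complex)) \<Rightarrow> ('k \<Rightarrow>\<^sub>0 complex) fps" where
  "fps_subst Y a = Abs_fps (\<lambda>n. \<Sum>r\<le>n. scl ((Y ^ r) $ n) (a r))"

lemma fps_subst_nth:
  assumes "Y $ 0 = 0" "n \<le> m"
  shows "fps_subst Y a $ n = (\<Sum>r\<le>m. scl ((Y ^ r) $ n) (a r))"
  unfolding fps_subst_def fps_nth_Abs_fps
  by (rule sum.mono_neutral_left) (use assms in \<open>auto simp: startsby_zero_power_prefix\<close>)

text \<open>Substitution is multiplicative: expand both factors, collect the powers of \<open>Y\<close> by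
  \<open>Y\<^bsup>s\<^esup> Y\<^bsup>s'\<^esup> = Y\<^bsup>s + s'\<^esup>\<close>, and sum over the triangle \<open>s + s' \<le> n\<close> along its diagonals.\<close>

lemma fps_subst_convolution:
  fixes a b :: "nat \<Rightarrow> ('k::monoid_add \<Rightarrow>\<^sub>0 complex)"
  assumes Y: "Y $ 0 = 0"
  shows "fps_subst Y (\<lambda>r. \<Sum>s\<le>r. a s * b (r - s)) = fps_subst Y a * fps_subst Y b"
proof (rule fps_ext)
  fix n
  have "(fps_subst Y a * fps_subst Y b) $ n =
      (\<Sum>m\<le>n. (\<Sum>s\<le>n. scl ((Y ^ s) $ m) (a s)) * (\<Sum>s'\<le>n. scl ((Y ^ s') $ (n - m)) (b s')))"
    unfolding fps_mult_nth atMost_atLeast0[symmetric]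
    by (rule sum.cong) (simp_all add: fps_subst_nth[OF Y, where m = n])
  also have "\<dots> = (\<Sum>m\<le>n. \<Sum>x\<in>{..n}\<times>{..n}. scl ((Y ^ fst x) $ m * (Y ^ snd x) $ (n - m)) (a (fst x) * b (snd x)))"
    by (simp add: sum_product sum.cartesian_product' scl_times_left scl_times_right mult.commute)
  also have "\<dots> = (\<Sum>x\<in>{..n}\<times>{..n}. \<Sum>m\<le>n. scl ((Y ^ fst x) $ m * (Y ^ snd x) $ (n - m)) (a (fst x) * b (snd x)))"
    by (rule sum.swap)
  also have "\<dots> = (\<Sum>x\<in>{..n}\<times>{..n}. scl ((Y ^ (fst x + snd x)) $ n) (a (fst x) * b (snd x)))"
  proof (rule sum.cong[OF refl])
    fix x
    have "(Y ^ (fst x + snd x)) $ n = (\<Sum>m\<le>n. (Y ^ fst x) $ m * (Y ^ snd x) $ (n - m))"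
      by (simp add: power_add fps_mult_nth atMost_atLeast0)
    moreover have "(\<Sum>m\<le>n. scl (c m) p) = scl (\<Sum>m\<le>n. c m) p" for c :: "nat \<Rightarrow> complex" and p :: "'k \<Rightarrow>\<^sub>0 complex"
      by (rule poly_mapping_eqI) (simp add: lookup_sum sum_distrib_right)
    ultimately show "(\<Sum>m\<le>n. scl ((Y ^ fst x) $ m * (Y ^ snd x) $ (n - m)) (a (fst x) * b (snd x))) =
        scl ((Y ^ (fst x + snd x)) $ n) (a (fst x) * b (snd x))" by simp
  qed
  also have "\<dots> = (\<Sum>x\<in>{(s, s'). s + s' \<le> n}. scl ((Y ^ (fst x + snd x)) $ n) (a (fst x) * b (snd x)))"
    by (rule sum.mono_neutral_right)
      (auto, rule ccontr, simp add: startsby_zero_power_prefix[OF Y] not_le)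
  also have "\<dots> = (\<Sum>(s, s')\<in>{(s, s'). s + s' \<le> n}. scl ((Y ^ (s + s')) $ n) (a s * b s'))"
    by (simp add: case_prod_beta)
  also have "\<dots> = (\<Sum>r\<le>n. \<Sum>s\<le>r. scl ((Y ^ (s + (r - s))) $ n) (a s * b (r - s)))"
    by (rule sum.triangle_reindex_eq)
  also have "\<dots> = fps_subst Y (\<lambda>r. \<Sum>s\<le>r. a s * b (r - s)) $ n"
    by (simp add: fps_subst_def scl_sum)
  finally show "fps_subst Y (\<lambda>r. \<Sum>s\<le>r. a s * b (r - s)) $ n = (fps_subst Y a * fps_subst Y b) $ n" ..
qed

lemma fps_subst_sum: "fps_subst Y (\<lambda>r. \<Sum>k\<in>I. a k r) = (\<Sum>k\<in>I. fps_subst Y (a k))"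
proof (rule fps_ext)
  fix n
  show "fps_subst Y (\<lambda>r. \<Sum>k\<in>I. a k r) $ n = (\<Sum>k\<in>I. fps_subst Y (a k)) $ n"
    by (simp add: fps_subst_def fps_sum_nth scl_sum) (rule sum.swap)
qed

text \<open>An argument \<open>x = \<plusminus> u + c\<close> has order \<open>- 1\<close> in \<open>1/u\<close>, so that \<open>1/x\<close> is a power series without constant
  term.\<close>

lemma t_at_eq:
  assumes x: "fls_subdegree x = -1"
  obtains Y where "Y $ 0 = 0" "\<And>i j. t_at x i j = fps_to_fls (fps_subst Y (\<lambda>r. letter (i, j, r)))"
proof
  let ?Y = "fls_regpart (inverse x)"
  have inv: "inverse x = fps_to_fls ?Y"
  proof (rule fls_eqI)
    fix k
    show "inverse x $$ k = fps_to_fls ?Y $$ k"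
      using fls_eq0_below_subdegree[of k "inverse x"] by (cases "k < 0") (simp_all add: x)
  qed
  show "?Y $ 0 = 0" using fls_eq0_below_subdegree[of 0 "inverse x"] by (simp add: x)
  have "inverse x ^ r = fps_to_fls (?Y ^ r)" for r
    by (subst inv) (simp add: fps_to_fls_power)
  then show "t_at x i j = fps_to_fls (fps_subst ?Y (\<lambda>r. letter (i, j, r)))" for i j
    by (simp add: t_at_def fps_subst_def scalar_times)
qed

lemma lin_ext_fps_subst:
  "Abs_fps (\<lambda>n. lin_ext f (fps_subst Y a $ n)) = fps_subst Y (\<lambda>r. lin_ext f (a r))"
  by (simp add: fps_subst_def lin_ext_sum lin_ext_scl)

text \<open>The formula for the coproduct of \<open>t\<^bsub>ij\<^esub>(u)\<close> persists after a substitution, as substitution is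
  additive and multiplicative.\<close>

lemma comult_t_at:
  assumes "fls_subdegree x = -1"
  shows "fls_map (comult N) (t_at x i j) =
    (\<Sum>k\<in>index_set N. fls_map inl_free (t_at x i k) * fls_map inr_free (t_at x k j))"
proof -
  obtain Y where Y: "Y $ 0 = 0"
    and t: "\<And>i j. t_at x i j = fps_to_fls (fps_subst Y (\<lambda>r. letter (i, j, r)))"
    by (rule t_at_eq[OF assms]) blast
  have c: "Abs_fps (\<lambda>n. comult N (fps_subst Y a $ n)) = fps_subst Y (\<lambda>r. comult N (a r))" for a
    unfolding comult_def free_hom_def by (rule lin_ext_fps_subst)
  have l: "Abs_fps (\<lambda>n. inl_free (fps_subst Y a $ n)) = fps_subst Y (\<lambda>r. inl_free (a r))" for a
    unfolding inl_free_def by (rule lin_ext_fps_subst)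
  have r: "Abs_fps (\<lambda>n. inr_free (fps_subst Y a $ n)) = fps_subst Y (\<lambda>r. inr_free (a r))" for a
    unfolding inr_free_def by (rule lin_ext_fps_subst)
  have sum: "fps_to_fls (\<Sum>k\<in>I. f k) = (\<Sum>k\<in>I. fps_to_fls (f k))" for I and f :: "int \<Rightarrow> gen free2 fps"
    by (rule fls_eqI) (simp add: fls_nth_sum fps_sum_nth)
  have "fls_map (comult N) (t_at x i j) = fps_to_fls (\<Sum>k\<in>index_set N.
      fps_subst Y (\<lambda>r. inl_free (letter (i, k, r))) * fps_subst Y (\<lambda>r. inr_free (letter (k, j, r))))"
    unfolding t comult_ring.fls_map_fps_to_fls c comult_letter fps_subst_sum
    by (intro arg_cong[of _ _ fps_to_fls] sum.cong refl fps_subst_convolution[OF Y])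
  then show ?thesis
    by (simp add: t inl_ring.fls_map_fps_to_fls inr_ring.fls_map_fps_to_fls l r sum fls_times_fps_to_fls)
qed

section \<open>The coproduct of the matrix S(u)\<close>

lemma uminus_index_set: "- k \<in> index_set N \<longleftrightarrow> k \<in> index_set N"
  by (auto simp: index_set_def)

lemma sum_uminus_index_set: "(\<Sum>k\<in>index_set N. f (- k)) = (\<Sum>k\<in>index_set N. f k)"
  by (rule sum.reindex_bij_witness[of _ uminus uminus]) (simp_all add: uminus_index_set)

lemma transp_at_eq:
  assumes "k \<in> index_set N" "l \<in> index_set N"
  shows "transp_at F N x k l = fls_const (scalar (theta F (- l) (- k))) * t_at x (- l) (- k)"
proof -
  have "transp_at F N x k l = (\<Sum>i\<in>index_set N. \<Sum>j\<in>index_set N.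
      if i = - l then if j = - k then fls_const (scalar (theta F i j)) * t_at x i j else 0 else 0)"
    unfolding transp_at_def by (intro sum.cong refl) (auto simp: unit_matrix_def)
  also have "\<dots> = (\<Sum>i\<in>index_set N. if i = - l then (\<Sum>j\<in>index_set N.
      if j = - k then fls_const (scalar (theta F i j)) * t_at x i j else 0) else 0)"
    by (intro sum.cong refl) auto
  also have "\<dots> = fls_const (scalar (theta F (- l) (- k))) * t_at x (- l) (- k)"
    using assms by (simp add: uminus_index_set)
  finally show ?thesis .
qed

text \<open>In the symplectic case \<open>sgn m\<close> has square \<open>1\<close> because \<open>0\<close> is not an index for even \<open>N\<close>.\<close>

lemma theta_mult:
  assumes "F = Symplectic \<longrightarrow> even N" "m \<in> index_set N"
  shows "theta F i m * theta F m j = theta F i j"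
proof (cases F)
  case Symplectic
  then have "m \<noteq> 0" using assms by (auto simp: index_set_def)
  then have "sgn m * sgn m = 1" by (auto simp: sgn_if)
  then have "(sgn i * sgn m) * (sgn m * sgn j) = sgn i * sgn j"
    by (metis mult.assoc mult.commute mult_1)
  then have "(of_int ((sgn i * sgn m) * (sgn m * sgn j)) :: complex) = of_int (sgn i * sgn j)"
    by (rule arg_cong)
  then show ?thesis using Symplectic by (simp only: theta_def family.case of_int_mult)
qed (simp add: theta_def)

lemma scalar_central:
  "fls_const (Poly_Mapping.single 0 c) * f = f * fls_const (Poly_Mapping.single 0 c)"
  for f :: "('k::monoid_add \<Rightarrow>\<^sub>0 complex) fls"
  by (rule fls_eqI)
    (simp add: single_zero_times, metis scl_times_right scl_of_one mult_1_right)

text \<open>The reversed order of the tensor factors compared with \<open>comult_t_at\<close> is the effect of the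
  transposition; the summation index changes its sign.\<close>

lemma comult_transp_at:
  assumes F: "F = Symplectic \<longrightarrow> even N" and x: "fls_subdegree x = -1"
    and k: "k \<in> index_set N" and l: "l \<in> index_set N"
  shows "fls_map (comult N) (transp_at F N x k l) =
    (\<Sum>m\<in>index_set N. fls_map inr_free (transp_at F N x k m) * fls_map inl_free (transp_at F N x m l))"
proof -
  let ?s = "\<lambda>c. fls_const (Poly_Mapping.single 0 c) :: gen free2 fls"
  let ?t1 = "\<lambda>i j. fls_map inl_free (t_at x i j)" and ?t2 = "\<lambda>i j. fls_map inr_free (t_at x i j)"
  have commute: "?t1 i j * ?t2 i' j' = ?t2 i' j' * ?t1 i j" for i j i' j'
    by (rule fls_times_commute) (simp add: inr_times_inl)
  have "fls_map (comult N) (transp_at F N x k l) =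
      (\<Sum>m\<in>index_set N. ?s (theta F (- l) (- k)) * (?t1 (- l) m * ?t2 m (- k)))"
    by (simp add: transp_at_eq[OF k l] fls_comult.mult comult_ring.fls_map_const comult_scalar
        comult_t_at[OF x] sum_distrib_left)
  also have "\<dots> = (\<Sum>m\<in>index_set N. ?s (theta F (- l) (- k)) * (?t1 (- l) (- m) * ?t2 (- m) (- k)))"
    by (rule sum_uminus_index_set[symmetric])
  also have "\<dots> = (\<Sum>m\<in>index_set N. fls_map inr_free (transp_at F N x k m) * fls_map inl_free (transp_at F N x m l))"
  proof (rule sum.cong[OF refl])
    fix m assume m: "m \<in> index_set N"
    have "?s (theta F (- l) (- k)) = ?s (theta F (- m) (- k)) * ?s (theta F (- l) (- m))"
      using theta_mult[OF F, of "- m" "- l" "- k"] m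
      by (simp add: mult_single uminus_index_set mult.commute)
    then have "?s (theta F (- l) (- k)) * (?t1 (- l) (- m) * ?t2 (- m) (- k)) =
        ?s (theta F (- m) (- k)) * (?s (theta F (- l) (- m)) * ?t2 (- m) (- k)) * ?t1 (- l) (- m)"
      by (simp only: commute mult.assoc)
    also have "\<dots> = ?s (theta F (- m) (- k)) * (?t2 (- m) (- k) * ?s (theta F (- l) (- m))) * ?t1 (- l) (- m)"
      by (simp only: scalar_central)
    finally show "?s (theta F (- l) (- k)) * (?t1 (- l) (- m) * ?t2 (- m) (- k)) =
        fls_map inr_free (transp_at F N x k m) * fls_map inl_free (transp_at F N x m l)"
      by (simp add: transp_at_eq[OF k m] transp_at_eq[OF m l] fls_inl.mult fls_inr.mult
          inl_ring.fls_map_const inr_ring.fls_map_const inl_free_scalar inr_free_scalar mult.assoc)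
  qed
  finally show ?thesis .
qed

lemma index_matrix_mult_assoc:
  "index_matrix_mult N (index_matrix_mult N A B) C = index_matrix_mult N A (index_matrix_mult N B C)"
  by (auto simp: fun_eq_iff index_matrix_mult_def sum_distrib_left sum_distrib_right mult.assoc intro: sum.swap)

lemma index_matrix_mult_cong:
  "(\<And>a. a \<in> index_set N \<Longrightarrow> A i a = A' i a) \<Longrightarrow> (\<And>a. a \<in> index_set N \<Longrightarrow> B a j = B' a j) \<Longrightarrow>
    index_matrix_mult N A B i j = index_matrix_mult N A' B' i j"
  by (simp add: index_matrix_mult_def)

lemma (in ring_morphism) index_matrix_mult:
  "h (index_matrix_mult N A B i j) = index_matrix_mult N (\<lambda>i j. h (A i j)) (\<lambda>i j. h (B i j)) i j"
  by (simp add: index_matrix_mult_def sum mult)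

lemma S_series_eq:
  "S_series L i j = index_matrix_mult (pair_size L)
     (index_matrix_mult (pair_size L) (t_at (fls_X_inv - fls_const (kappa (pair_family L) (pair_size L) / 2)))
       (\<lambda>a b. fls_map scalar (G_series L a b)))
     (transp_at (pair_family L) (pair_size L) (- fls_X_inv + fls_const (kappa (pair_family L) (pair_size L) / 2))) i j"
  unfolding S_series_def index_matrix_mult_def Let_def sum_distrib_right by (rule sum.swap)

lemma subdegree_shift:
  "fls_subdegree (fls_X_inv - fls_const h :: complex fls) = -1"
  "fls_subdegree (- fls_X_inv + fls_const h :: complex fls) = -1"
  by (rule fls_subdegree_eqI; simp)+

text \<open>The scalar series \<open>\<G>(u)\<close> can be regarded as lying in the right tensor factor.  The product
  \<open>T\<^sub>1 T\<^sub>2 \<G>\<^sub>2 T\<^sup>t\<^sub>2 T\<^sup>t\<^sub>1\<close> then contains \<open>S\<^sub>2 = T\<^sub>2 \<G>\<^sub>2 T\<^sup>t\<^sub>2\<close> by associativity alone.\<close>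

lemma comult_S_series:
  fixes L
  defines "F \<equiv> pair_family L" and "N \<equiv> pair_size L"
  defines "h \<equiv> kappa F N / 2"
  assumes F: "F = Symplectic \<longrightarrow> even N" and i: "i \<in> index_set N" and j: "j \<in> index_set N"
  shows "fls_map (comult N) (S_series L i j) =
    (\<Sum>d\<in>index_set N. (\<Sum>c\<in>index_set N. fls_map inl_free (t_at (fls_X_inv - fls_const h) i c) *
        fls_map inr_free (S_series L c d)) * fls_map inl_free (transp_at F N (- fls_X_inv + fls_const h) d j))"
proof -
  let ?m = "index_matrix_mult N"
  let ?t = "t_at (fls_X_inv - fls_const h)" and ?t' = "transp_at F N (- fls_X_inv + fls_const h)"
  let ?g = "\<lambda>a b. fls_map scalar (G_series L a b)"
  let ?l = "\<lambda>A i j. fls_map inl_free (A i j)" and ?r = "\<lambda>A i j. fls_map inr_free (A i j)"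
    and ?c = "\<lambda>A i j. fls_map (comult N) (A i j)"
  have S: "S_series L = ?m (?m ?t ?g) ?t'"
    by (auto simp: fun_eq_iff S_series_eq F_def N_def h_def)
  have g: "?c ?g = ?r ?g"
    by (intro ext fls_eqI) (simp add: fls_nth_fls_map comult_scalar inr_free_scalar)
  have t: "?c ?t = ?m (?l ?t) (?r ?t)"
    by (intro ext) (simp add: index_matrix_mult_def comult_t_at[OF subdegree_shift(1)])
  have t': "?c ?t' a b = ?m (?r ?t') (?l ?t') a b" if "a \<in> index_set N" "b \<in> index_set N" for a b
    unfolding index_matrix_mult_def by (rule comult_transp_at[OF F subdegree_shift(2) that])
  have "?c (S_series L) i j = ?m (?m (?c ?t) (?c ?g)) (?c ?t') i j"
    by (simp add: S fls_comult.index_matrix_mult)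
  also have "\<dots> = ?m (?m (?m (?l ?t) (?r ?t)) (?r ?g)) (?m (?r ?t') (?l ?t')) i j"
    unfolding t g by (rule index_matrix_mult_cong) (rule refl, rule t'[OF _ j])
  also have "\<dots> = ?m (?m (?l ?t) (?m (?m (?r ?t) (?r ?g)) (?r ?t'))) (?l ?t') i j"
    by (simp only: index_matrix_mult_assoc)
  also have "?m (?m (?r ?t) (?r ?g)) (?r ?t') = ?r (S_series L)"
    by (intro ext) (simp add: S fls_inr.index_matrix_mult)
  finally show ?thesis by (simp only: index_matrix_mult_def)
qed

section \<open>The coideal property\<close>

context yangian
begin

lemma t_at_closed:
  assumes "i \<in> index_set N" "j \<in> index_set N"
  shows "t_at x i j \<in> fls_over (carrier Fr)"
proof -
  have "letter (i, j, r) \<in> carrier Fr" for r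
    using assms by (intro letter_closed) (simp add: generators_def)
  then show ?thesis
    unfolding t_at_def using add_closed_Fr
    by (intro fls_over_fps_to_fls)
      (auto intro!: add_closed_sum[OF add_closed_Fr] Fr_times_closed scalar_closed simp: add_closed_def)
qed

lemma fls_over_Fr_times:
  "f \<in> fls_over (carrier Fr) \<Longrightarrow> g \<in> fls_over (carrier Fr) \<Longrightarrow> f * g \<in> fls_over (carrier Fr)"
  by (rule fls_over_times[OF add_closed_Fr Fr_times_closed])

lemma transp_at_closed:
  assumes "k \<in> index_set N" "l \<in> index_set N"
  shows "transp_at F N x k l \<in> fls_over (carrier Fr)"
proof -
  have "0 \<in> carrier Fr" using add_closed_Fr by (simp add: add_closed_def)
  then show ?thesis
    unfolding transp_at_eq[OF assms] using assms
    by (intro fls_over_Fr_times t_at_closed fls_over_const scalar_closed) (simp_all add: uminus_index_set)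
qed

lemma index_matrix_mult_closed:
  assumes "\<And>a. a \<in> index_set N \<Longrightarrow> A i a \<in> fls_over (carrier Fr)"
    "\<And>a. a \<in> index_set N \<Longrightarrow> B a j \<in> fls_over (carrier Fr)"
  shows "index_matrix_mult N A B i j \<in> fls_over (carrier Fr)"
  unfolding index_matrix_mult_def
  by (intro add_closed_sum[OF add_closed_fls_over[OF add_closed_Fr]] fls_over_Fr_times assms)

text \<open>Coefficients of the product are sums of elements \<open>(p \<otimes> 1) (1 \<otimes> s) (q \<otimes> 1) = p q \<otimes> s\<close>.\<close>

lemma tensor_proj_sandwich:
  assumes Y: "Y \<subseteq> carrier X" and f: "f \<in> fls_over (carrier Fr)" and g: "g \<in> fls_over (carrier Fr)"
    and s: "s \<in> fls_over {p \<in> carrier Fr. proj p \<in> Y}"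
  shows "fls_map inl_free f * fls_map inr_free s * fls_map inl_free g \<in>
    fls_over {b \<in> carrier FF. tensor_proj b \<in> tensor_subspace X X (carrier X) Y}"
    (is "_ \<in> fls_over ?V")
proof -
  have "submodule (tensor_subspace X X (carrier X) Y) complex_ring XX"
    unfolding tensor_subspace_def XX_alg_def
    by (rule XX.AB.submodule_linear_span) (use Y XX.pure_tensor_closed in blast)
  then have "submodule ?V complex_ring FF" by (rule tensor_proj.submodule_vimage)
  then have V: "add_closed ?V" by (simp add: FF.submodule_iff add_closed_def)
  let ?A = "inl_free ` carrier Fr" and ?B = "inr_free ` {p \<in> carrier Fr. proj p \<in> Y}"
  \<comment> \<open>The set \<open>?V\<close> is not an ideal; \<open>?W\<close> collects the elements that the last factor takes into it.\<close>
  let ?W = "{b. \<forall>a\<in>?A. b * a \<in> ?V}"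
  have W: "add_closed ?W" using V by (simp add: add_closed_def distrib_right)
  have AB: "a * b \<in> ?W" if "a \<in> ?A" "b \<in> ?B" for a b
  proof -
    from that obtain p s where ps: "a = inl_free p" "b = inr_free s" "p \<in> carrier Fr" "s \<in> carrier Fr" "proj s \<in> Y"
      by blast
    have "a * b * inl_free q \<in> ?V" if q: "q \<in> carrier Fr" for q
    proof -
      have pq: "p * q \<in> carrier Fr" using ps(3) q by (rule Fr_times_closed)
      have "a * b * inl_free q = inl_free (p * q) * inr_free s"
        by (simp add: ps(1,2) inl_ring.mult mult.assoc inr_times_inl)
      moreover have "inl_free (p * q) * inr_free s \<in> carrier FF"
        using pq ps(4) by (intro FF_times_closed inl.hom_closed inr.hom_closed)
      moreover have "tensor_proj (inl_free (p * q) * inr_free s) \<in> tensor_subspace X X (carrier X) Y"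
        unfolding tensor_proj_pure[OF pq ps(4)]
        using ps(5) pq by (intro XX.pure_tensor_in_tensor_subspace proj.hom_closed)
      ultimately show ?thesis by simp
    qed
    then show ?thesis by blast
  qed
  have "fls_map inl_free f \<in> fls_over ?A" "fls_map inl_free g \<in> fls_over ?A" "fls_map inr_free s \<in> fls_over ?B"
    using f g s by (auto simp: fls_over_def)
  note fgs = this
  have "fls_map inl_free f * fls_map inr_free s \<in> fls_over ?W"
    by (rule fls_over_times[OF W AB fgs(1,3)])
  then show ?thesis
    by (rule fls_over_times[OF V _ _ fgs(2), rotated]) blast
qed

end

theorem proposition3p2:
  fixes L :: symmetric_pair
  assumes "admissible L"
  shows "let F = pair_family L; N = pair_size L;
             X = X_alg F N; Y = twisted_yangian L
         in subalg Y X \<and> coproduct F N ` Y \<subseteq> tensor_subspace X X (carrier X) Y"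
proof -
  define F N where "F = pair_family L" and "N = pair_size L"
  interpret yangian F N .
  let ?Y = "twisted_yangian L"
  let ?S = "{proj (S_series L i j $$ n) |i j n. i \<in> index_set N \<and> j \<in> index_set N}"
  let ?V = "tensor_subspace X X (carrier X) ?Y"
  \<comment> \<open>Oddness of \<open>N\<close> is excluded for symplectic types by admissibility; \<open>\<theta>\<close> is then multiplicative.\<close>
  have F: "F = Symplectic \<longrightarrow> even N"
    using assms by (cases L) (auto simp: F_def N_def)
  have Y_eq: "?Y = generated_subalg X ?S"
    by (simp add: twisted_yangian_def Let_def F_def N_def)
  have S_closed: "S_series L i j \<in> fls_over (carrier Fr)" if "i \<in> index_set N" "j \<in> index_set N" for i j
    unfolding S_series_eq F_def[symmetric] N_def[symmetric]
    using that by (intro index_matrix_mult_closed t_at_closed transp_at_closed fls_map_scalar_closed)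
  have S_X: "?S \<subseteq> carrier X"
    using S_closed by (auto simp: fls_over_def)
  have Y: "subalg ?Y X" unfolding Y_eq by (rule X.subalg_generated_subalg[OF S_X])
  then have Y_X: "?Y \<subseteq> carrier X" by (simp add: X.subalg_iff X.submodule_iff)
  interpret co: unital_algebra_hom X XX "coproduct F N" by (rule coproduct_hom)
  have V: "subalg ?V XX"
    unfolding XX_alg_def by (rule XX.subalg_tensor_subspace[OF X.subalg_carrier Y])
  have "?S \<subseteq> {x \<in> carrier X. coproduct F N x \<in> ?V}"
  proof (clarify, intro conjI)
    fix i j n assume ij: "i \<in> index_set N" "j \<in> index_set N"
    have Sn: "S_series L i j $$ n \<in> carrier Fr" using S_closed[OF ij] by (simp add: fls_over_def)
    then show "proj (S_series L i j $$ n) \<in> carrier X" by simp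
    let ?h = "kappa F N / 2"
    let ?W = "{b \<in> carrier FF. tensor_proj b \<in> ?V}"
    have "submodule ?W complex_ring FF"
      by (rule tensor_proj.submodule_vimage) (use V tensor_proj.B.subalg_iff in blast)
    then have W: "add_closed ?W" by (simp add: FF.submodule_iff add_closed_def)
    have S_Y: "S_series L c d \<in> fls_over {p \<in> carrier Fr. proj p \<in> ?Y}"
      if "c \<in> index_set N" "d \<in> index_set N" for c d
      using S_closed[OF that] X.subset_generated_subalg[of ?S] that unfolding Y_eq fls_over_def by blast
    have "fls_map (comult N) (S_series L i j) \<in> fls_over ?W"
      unfolding N_def comult_S_series[OF F[unfolded F_def N_def] ij[unfolded N_def]] sum_distrib_right
      unfolding F_def[symmetric] N_def[symmetric]
      by (intro add_closed_sum[OF add_closed_fls_over[OF W]] tensor_proj_sandwich[OF Y_X] S_Y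
          t_at_closed transp_at_closed ij)
    then have "comult N (S_series L i j $$ n) \<in> ?W" by (simp add: fls_over_def)
    then show "coproduct F N (proj (S_series L i j $$ n)) \<in> ?V"
      by (simp add: coproduct_proj[OF Sn])
  qed
  then have "?Y \<subseteq> {x \<in> carrier X. coproduct F N x \<in> ?V}"
    unfolding Y_eq by (rule X.generated_subalg_minimal[OF co.subalg_vimage[OF V[unfolded Y_eq]]])
  then show ?thesis
    using Y by (auto simp: Let_def F_def N_def)
qed

end
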